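(* Let $(X,\alpha)$ and $(Y,\beta)$ be two $\mathcal V_w$-algebras, viewed as topological cones with the cone structures induced by $\alpha$ and $\beta$ respectively. If $Y$ is convex-$T_0$, then the $\mathcal V_w$-algebra morphisms from $(X,\alpha)$ to $(Y,\beta)$ are precisely the continuous linear maps from $X$ to $Y$.
   Context: $\mathbb R_+=[0,\infty)$ and $\overline{\mathbb R}_+=[0,\infty]$, both with the Scott topology (proper nonempty opens are the sets of elements $>r$, $r\in\mathbb R_+$). $\mathbf{TOP}_0$ is the category of $T_0$ topological spaces and continuous maps. Valuations. A continuous valuation on a space $X$ with lattice of opens $\mathcal OX$ is a map $\mu\colon\mathcal OX\to\overline{\mathbb R}_+$ with $\mu(\emptyset)=0$, $\mu(U)\le\mu(V)$ if $U\subseteq V$, $\mu(U)+\mu(V)=\mu(U\cup V)+\mu(U\cap V)$, and $\mu(\bigcup_iU_i)=\sup_i\mu(U_i)$ for directed families of opens. $\delta_x(U)=1$ if $x\in U$, and $0$ otherwise. Linear combinations of valuations are formed pointwise. $\mathcal V_wX$ is the set of all continuous valuations on $X$ with the weak topology, generated by the subbasic sets $[U>r]=\{\mu\mid\mu(U)>r\}$, $U\in\mathcal OX$, $r\in\mathbb R_+$. For continuous $h\colon X\to\overline{\mathbb R}_+$ (i.e. $h$ lower semi-continuous), $\int h\,d\mu=\int_0^\infty\mu(h^{-1}((r,\infty]))\,dr$ (Riemann integral). The monad. $\mathcal V_w$ is an endofunctor with $\mathcal V_wf(\mu)(V)=\mu(f^{-1}(V))$; it is a monad with unit $\eta_X(x)=\delta_x$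 and multiplication $m_X(\varpi)(U)=\int_{\mu\in\mathcal V_wX}\mu(U)\,d\varpi$ for $\varpi\in\mathcal V_w\mathcal V_wX$. A $\mathcal V_w$-algebra (on $\mathbf{TOP}_0$) is a pair $(X,\alpha)$ of a $T_0$ space $X$ and a continuous map $\alpha\colon\mathcal V_wX\to X$ with $\alpha\circ\eta_X=\mathrm{id}_X$ and $\alpha\circ m_X=\alpha\circ\mathcal V_w\alpha$. A $\mathcal V_w$-algebra morphism from $(X,\alpha)$ to $(Y,\beta)$ is a continuous map $f\colon X\to Y$ with $\beta\circ\mathcal V_wf=f\circ\alpha$. The cone structure induced by $(X,\alpha)$ is $x+y=\alpha(\delta_x+\delta_y)$, $r\cdot x=\alpha(r\delta_x)$ for $x,y\in X$, $r\in\mathbb R_+$; with it $X$ is a topological cone. Cones. A cone is a commutative monoid $(C,+,0)$ with a scalar multiplication $\mathbb R_+\times C\to C$ such that $r(x+y)=rx+ry$, $(r+s)x=rx+sx$, $(rs)x=r(sx)$, $1x=x$, $0x=0$, $r0=0$. A semitopological (resp. topological) cone is a cone with a $T_0$ topology making $+$ and scalar multiplication separately (resp. jointly) continuous. A map $f$ between cones is linear if $f(rx+sy)=rf(x)+sf(y)$ for all $r,s\in\mathbb R_+$; $\overline{\mathbb R}_+$ is a cone with $0\cdot\infty=0$. A semitopological cone $C$ is convex-$T_0$ if for every pair of distinct points $a,b$ of $C$ there is a lower semi-continuous linear map $\Lambda\colon C\to\overline{\mathbb R}_+$ with $\Lambda(a)\ne\Lambda(b)$. *)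

theory Defs
  imports "HOL-Analysis.Analysis"
begin

section \<open>Continuous valuations\<close>

definition directed_family :: "'a set set \<Rightarrow> bool" where
  "directed_family D \<longleftrightarrow> D \<noteq> {} \<and> (\<forall>A\<in>D. \<forall>B\<in>D. \<exists>C\<in>D. A \<union> B \<subseteq> C)"

text \<open>A valuation is a map on the lattice of open sets. It is represented by a function on all
  subsets that takes the value \<open>0\<close> outside the open sets, so that two valuations
  are equal as soon as they agree on the open sets.\<close>

definition continuous_valuation :: "('a::topological_space set \<Rightarrow> ennreal) \<Rightarrow> bool" where
  "continuous_valuation \<mu> \<longleftrightarrow>
     (\<forall>U. \<not> open U \<longrightarrow> \<mu> U = 0) \<and>
     \<mu> {} = 0 \<and>
     (\<forall>U V. open U \<longrightarrow> open V \<longrightarrow> U \<subseteq> V \<longrightarrow> \<mu> U \<le> \<mu> V) \<and>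
     (\<forall>U V. open U \<longrightarrow> open V \<longrightarrow> \<mu> U + \<mu> V = \<mu> (U \<union> V) + \<mu> (U \<inter> V)) \<and>
     (\<forall>D. directed_family D \<longrightarrow> (\<forall>U\<in>D. open U) \<longrightarrow> \<mu> (\<Union>D) = (SUP U\<in>D. \<mu> U))"

typedef (overloaded) 'a valuation =
  "{\<mu> :: 'a::topological_space set \<Rightarrow> ennreal. continuous_valuation \<mu>}"
  morphisms val Abs_valuation
proof
  show "(\<lambda>_. 0) \<in> {\<mu> :: 'a set \<Rightarrow> ennreal. continuous_valuation \<mu>}"
    by (auto simp: continuous_valuation_def directed_family_def)
qed

lemma continuous_valuation_val: "continuous_valuation (val \<mu>)"
  using val by auto

lemma continuous_valuationI:
  assumes "\<And>U. \<not> open U \<Longrightarrow> \<mu> U = 0" and "\<mu> {} = 0"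
    and "\<And>U V. open U \<Longrightarrow> open V \<Longrightarrow> U \<subseteq> V \<Longrightarrow> \<mu> U \<le> \<mu> V"
    and "\<And>U V. open U \<Longrightarrow> open V \<Longrightarrow> \<mu> U + \<mu> V = \<mu> (U \<union> V) + \<mu> (U \<inter> V)"
    and "\<And>D. directed_family D \<Longrightarrow> \<forall>U\<in>D. open U \<Longrightarrow> \<mu> (\<Union>D) = (SUP U\<in>D. \<mu> U)"
  shows "continuous_valuation \<mu>"
  unfolding continuous_valuation_def by (intro conjI allI impI assms)

lemma
  assumes "continuous_valuation \<mu>"
  shows valuation_not_open: "\<not> open U \<Longrightarrow> \<mu> U = 0"
    and valuation_empty: "\<mu> {} = 0"
    and valuation_mono: "open U \<Longrightarrow> open V \<Longrightarrow> U \<subseteq> V \<Longrightarrow> \<mu> U \<le> \<mu> V"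
    and valuation_modular: "open U \<Longrightarrow> open V \<Longrightarrow> \<mu> U + \<mu> V = \<mu> (U \<union> V) + \<mu> (U \<inter> V)"
    and valuation_SUP: "directed_family D \<Longrightarrow> \<forall>U\<in>D. open U \<Longrightarrow> \<mu> (\<Union>D) = (SUP U\<in>D. \<mu> U)"
  using assms unfolding continuous_valuation_def by simp_all

lemma valuation_eqI: "(\<And>U. open U \<Longrightarrow> val \<mu> U = val \<nu> U) \<Longrightarrow> \<mu> = \<nu>"
proof -
  assume eq: "\<And>U. open U \<Longrightarrow> val \<mu> U = val \<nu> U"
  have "val \<mu> U = 0 \<and> val \<nu> U = 0" if "\<not> open U" for U
    using that continuous_valuation_val valuation_not_open by blast
  with eq have "val \<mu> = val \<nu>" by (metis ext)
  then show "\<mu> = \<nu>" by (simp add: val_inject)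
qed

definition dirac :: "'a::topological_space \<Rightarrow> 'a valuation" where
  "dirac x = Abs_valuation (\<lambda>U. if open U \<and> x \<in> U then 1 else 0)"

lemma val_dirac: "val (dirac x) = (\<lambda>U. if open U \<and> x \<in> U then 1 else 0)"
proof -
  let ?d = "\<lambda>U. if open U \<and> x \<in> U then 1 else 0 :: ennreal"
  have sup: "?d (\<Union>D) = (SUP U\<in>D. ?d U)" if D: "\<forall>U\<in>D. open U" "D \<noteq> {}" for D
  proof (cases "x \<in> \<Union>D")
    case True
    then obtain W where "W \<in> D" "x \<in> W" by auto
    then have "(SUP U\<in>D. ?d U) \<ge> 1"
      using D by (intro SUP_upper2[of W]) auto
    moreover have "(SUP U\<in>D. ?d U) \<le> 1"
      by (rule SUP_least) simp
    ultimately show ?thesis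
      using True D by auto
  next
    case False
    then have "(SUP U\<in>D. ?d U) = (SUP U\<in>D. 0)"
      by (intro SUP_cong) auto
    then show ?thesis
      using False D by auto
  qed
  have "continuous_valuation ?d"
  proof (rule continuous_valuationI)
    show "?d (\<Union>D) = (SUP U\<in>D. ?d U)" if "directed_family D" "\<forall>U\<in>D. open U" for D
      using that by (intro sup) (simp_all add: directed_family_def)
    show "?d U + ?d V = ?d (U \<union> V) + ?d (U \<inter> V)" if "open U" "open V" for U V
      using that open_Un[OF that] open_Int[OF that] by (cases "x \<in> U"; cases "x \<in> V") simp_all
  qed (simp_all add: subset_iff)
  then show ?thesis
    unfolding dirac_def by (intro Abs_valuation_inverse CollectI)
qed

definition val_add ::
    "'a::topological_space valuation \<Rightarrow> 'a valuation \<Rightarrow> 'a valuation" where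
  "val_add \<mu> \<nu> = Abs_valuation (\<lambda>U. val \<mu> U + val \<nu> U)"

lemma continuous_valuation_add:
  assumes *: "continuous_valuation \<mu>" "continuous_valuation \<nu>"
  shows "continuous_valuation (\<lambda>U. \<mu> U + \<nu> U)"
proof -
  have mono: "\<mu> U \<le> \<mu> V \<and> \<nu> U \<le> \<nu> V" if "open U" "open V" "U \<subseteq> V" for U V
    using valuation_mono[OF *(1) that] valuation_mono[OF *(2) that] ..
  have sp: "\<mu> (\<Union>D) + \<nu> (\<Union>D) = (SUP U\<in>D. \<mu> U + \<nu> U)"
    if D: "directed_family D" "\<forall>U\<in>D. open U" for D
  proof -
    have "(SUP U\<in>D. \<mu> U + \<nu> U) = (SUP U\<in>D. \<mu> U) + (SUP U\<in>D. \<nu> U)"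
    proof (rule SUP_add_directed_ennreal)
      fix A B assume AB: "A \<in> D" "B \<in> D"
      then obtain C where "C \<in> D" "A \<union> B \<subseteq> C"
        using D unfolding directed_family_def by blast
      then show "\<exists>C\<in>D. \<mu> A + \<nu> B \<le> \<mu> C + \<nu> C"
        using mono[of A C] mono[of B C] AB D by (auto intro!: bexI[of _ C] add_mono)
    qed
    then show ?thesis
      using valuation_SUP[OF *(1) D] valuation_SUP[OF *(2) D] by simp
  qed
  have md: "\<mu> U + \<nu> U + (\<mu> V + \<nu> V) = \<mu> (U \<union> V) + \<nu> (U \<union> V) + (\<mu> (U \<inter> V) + \<nu> (U \<inter> V))"
    if "open U" "open V" for U V
  proof -
    have "\<mu> U + \<mu> V = \<mu> (U \<union> V) + \<mu> (U \<inter> V)" "\<nu> U + \<nu> V = \<nu> (U \<union> V) + \<nu> (U \<inter> V)"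
      using valuation_modular[OF *(1) that] valuation_modular[OF *(2) that] by simp_all
    then have "(\<mu> U + \<mu> V) + (\<nu> U + \<nu> V) =
        (\<mu> (U \<union> V) + \<mu> (U \<inter> V)) + (\<nu> (U \<union> V) + \<nu> (U \<inter> V))" by simp
    then show ?thesis by (simp add: ac_simps)
  qed
  have mn: "\<mu> U + \<nu> U \<le> \<mu> V + \<nu> V" if "open U" "open V" "U \<subseteq> V" for U V
    using mono[OF that] by (auto intro: add_mono)
  have zr: "\<mu> U + \<nu> U = 0" if "\<not> open U \<or> U = {}" for U
    using that by (auto simp: * valuation_not_open valuation_empty)
  show ?thesis
    by (rule continuous_valuationI[OF zr[OF disjI1] zr[OF disjI2[OF refl]] mn md sp])
qed

lemma val_val_add: "val (val_add \<mu> \<nu>) = (\<lambda>U. val \<mu> U + val \<nu> U)"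
  unfolding val_add_def
  by (intro Abs_valuation_inverse CollectI continuous_valuation_add continuous_valuation_val)

text \<open>Scalars are reals, and only \<open>r \<ge> 0\<close> is ever meant. In \<open>ennreal\<close>, \<open>0 * \<infinity> = 0\<close>.\<close>

definition val_scale :: "real \<Rightarrow> 'a::topological_space valuation \<Rightarrow> 'a valuation" where
  "val_scale r \<mu> = Abs_valuation (\<lambda>U. ennreal r * val \<mu> U)"

lemma continuous_valuation_scale:
  assumes *: "continuous_valuation \<mu>"
  shows "continuous_valuation (\<lambda>U. ennreal r * \<mu> U)"
proof -
  have md: "ennreal r * \<mu> U + ennreal r * \<mu> V = ennreal r * \<mu> (U \<union> V) + ennreal r * \<mu> (U \<inter> V)"
    if "open U" "open V" for U V
  proof -
    have "\<mu> U + \<mu> V = \<mu> (U \<union> V) + \<mu> (U \<inter> V)"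
      using valuation_modular[OF * that] .
    then show ?thesis by (metis distrib_left)
  qed
  have sp: "ennreal r * \<mu> (\<Union>D) = (SUP U\<in>D. ennreal r * \<mu> U)"
    if "directed_family D" "\<forall>U\<in>D. open U" for D
    unfolding SUP_mult_left_ennreal[symmetric] valuation_SUP[OF * that] ..
  have mn: "ennreal r * \<mu> U \<le> ennreal r * \<mu> V" if "open U" "open V" "U \<subseteq> V" for U V
    using valuation_mono[OF * that] by (rule mult_left_mono) simp
  have zr: "ennreal r * \<mu> U = 0" if "\<not> open U \<or> U = {}" for U
    using that by (auto simp: * valuation_not_open valuation_empty)
  show ?thesis
    by (rule continuous_valuationI[OF zr[OF disjI1] zr[OF disjI2[OF refl]] mn md sp])
qed

lemma val_val_scale: "val (val_scale r \<mu>) = (\<lambda>U. ennreal r * val \<mu> U)"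
  unfolding val_scale_def
  by (intro Abs_valuation_inverse CollectI continuous_valuation_scale continuous_valuation_val)


section \<open>The weak topology\<close>

instantiation valuation :: (topological_space) topological_space
begin

definition open_valuation :: "'a valuation set \<Rightarrow> bool" where
  "open_valuation =
     generate_topology {{\<mu>. val \<mu> U > ennreal r} | U r. open U \<and> r \<ge> 0}"

instance
proof
  show "open (UNIV :: 'a valuation set)"
    unfolding open_valuation_def by (rule generate_topology.UNIV)
  show "open (S \<inter> T)" if "open S" "open T" for S T :: "'a valuation set"
    using that unfolding open_valuation_def by (rule generate_topology.Int)
  show "open (\<Union>K)" if "\<forall>S\<in>K. open S" for K :: "'a valuation set set"
    using that unfolding open_valuation_def by (intro generate_topology.UN) blast
qed

end

lemma open_weak_subbasic: "open U \<Longrightarrow> r \<ge> 0 \<Longrightarrow> open {\<mu>. val \<mu> U > ennreal r}"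
  unfolding open_valuation_def by (rule generate_topology.Basis) auto

lemma ennreal_real_dense:
  fixes a b :: ennreal
  assumes "a < b"
  shows "\<exists>r\<ge>0. a < ennreal r \<and> ennreal r < b"
proof -
  obtain c where c: "a < c" "c < b" using dense[OF assms] by auto
  then obtain r where "c = ennreal r" "r \<ge> 0" by (cases c) auto
  with c show ?thesis by auto
qed

instance valuation :: (topological_space) t0_space
proof
  fix \<mu> \<nu> :: "'a valuation"
  assume "\<mu> \<noteq> \<nu>"
  then obtain U where U: "open U" "val \<mu> U \<noteq> val \<nu> U"
    using valuation_eqI by blast
  from U(2) consider "val \<mu> U < val \<nu> U" | "val \<nu> U < val \<mu> U" by (rule linorder_neqE)
  then obtain r where "r \<ge> 0"
    "\<not> (\<mu> \<in> {\<rho>. val \<rho> U > ennreal r} \<longleftrightarrow> \<nu> \<in> {\<rho>. val \<rho> U > ennreal r})"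
  proof cases
    case 1
    then obtain r where "r \<ge> 0" "val \<mu> U < ennreal r" "ennreal r < val \<nu> U"
      using ennreal_real_dense by blast
    then show ?thesis by (intro that[of r]) auto
  next
    case 2
    then obtain r where "r \<ge> 0" "val \<nu> U < ennreal r" "ennreal r < val \<mu> U"
      using ennreal_real_dense by blast
    then show ?thesis by (intro that[of r]) auto
  qed
  then show "\<exists>W. open W \<and> \<not> (\<mu> \<in> W \<longleftrightarrow> \<nu> \<in> W)"
    using open_weak_subbasic[OF U(1)] by blast
qed


section \<open>Integration of lower semi-continuous functions\<close>

text \<open>This is continuity for the Scott topology on \<open>ennreal\<close>. The predicate
  \<^const>\<open>continuous_on\<close> would refer to the order topology of \<open>ennreal\<close> instead.\<close>

definition lsc :: "('a::topological_space \<Rightarrow> ennreal) \<Rightarrow> bool" where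
  "lsc h \<longleftrightarrow> (\<forall>r\<ge>0. open {x. h x > ennreal r})"

text \<open>The integrand is antitone, so that its (improper, \<open>[0,\<infinity>]\<close>-valued) Riemann integral is also its
  Lebesgue integral; the lemma \<open>val_integral_Riemann\<close> exhibits it as the supremum of the lower
  Riemann sums on \<open>[0,n]\<close> of mesh \<open>1/2^n\<close>.\<close>

definition val_integral :: "'a::topological_space valuation \<Rightarrow> ('a \<Rightarrow> ennreal) \<Rightarrow> ennreal" where
  "val_integral \<mu> h = (\<integral>\<^sup>+ r\<in>{0..}. val \<mu> {x. h x > ennreal r} \<partial>lborel)"

lemma val_integral_Riemann:
  assumes h: "lsc h"
  shows "val_integral \<mu> h =
           (SUP n. \<Sum>i<n * 2^n. ennreal (1 / 2^n) * val \<mu> {x. h x > ennreal (real (Suc i) / 2^n)})"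
proof -
  define G where "G t = val \<mu> {x. h x > ennreal t}" for t :: real
  define p where "p n t = ((of_int \<lfloor>t * 2^n\<rfloor> + 1) / 2^n :: real)" for n :: nat and t :: real
  define g where "g n t = (if 0 \<le> t \<and> t < real n then G (p n t) else 0)" for n :: nat and t :: real
  have m: "continuous_valuation (val \<mu>)" by (rule continuous_valuation_val)
  have op: "open {x. h x > ennreal t}" if "t \<ge> 0" for t
    using h that unfolding lsc_def by blast
  have anti: "G t \<le> G s" if "0 \<le> s" "s \<le> t" for s t
  proof -
    have "{x. h x > ennreal t} \<subseteq> {x. h x > ennreal s}"
      using that by (auto intro: le_less_trans ennreal_leI)
    then show ?thesis
      using valuation_mono[OF m op[of t] op[of s]] that unfolding G_def by simp
  qed
  have p_gt: "t < p n t" for n t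
  proof -
    have "t * 2^n < of_int \<lfloor>t * 2^n\<rfloor> + 1" by linarith
    then show ?thesis by (simp add: p_def field_simps)
  qed
  have p_le: "p n t \<le> t + 1 / 2^n" for n t
  proof -
    have "of_int \<lfloor>t * 2^n\<rfloor> + 1 \<le> t * 2^n + 1" by linarith
    then show ?thesis by (simp add: p_def field_simps)
  qed
  have p_Suc: "p (Suc n) t \<le> p n t" for n t
  proof -
    define y where "y = t * 2^n"
    have "y < of_int \<lfloor>y\<rfloor> + 1" by linarith
    then have "2 * y < of_int (2 * (\<lfloor>y\<rfloor> + 1))"
      unfolding of_int_mult of_int_add of_int_numeral of_int_1 by (rule mult_strict_left_mono) simp
    then have "\<lfloor>2 * y\<rfloor> < 2 * (\<lfloor>y\<rfloor> + 1)"
      unfolding floor_less_iff .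
    then have "\<lfloor>2 * y\<rfloor> + 1 \<le> 2 * (\<lfloor>y\<rfloor> + 1)" by linarith
    then have "of_int (\<lfloor>2 * y\<rfloor> + 1) \<le> (of_int (2 * (\<lfloor>y\<rfloor> + 1)) :: real)"
      by (simp only: of_int_le_iff)
    then have "of_int \<lfloor>2 * y\<rfloor> + 1 \<le> 2 * (of_int \<lfloor>y\<rfloor> + 1 :: real)"
      by (simp only: of_int_mult of_int_add of_int_numeral of_int_1)
    then have "(of_int \<lfloor>2 * y\<rfloor> + 1) / (2 * 2^n) \<le> 2 * (of_int \<lfloor>y\<rfloor> + 1 :: real) / (2 * 2^n)"
      by (rule divide_right_mono) simp
    moreover have "p (Suc n) t = (of_int \<lfloor>2 * y\<rfloor> + 1) / (2 * 2^n)"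
      by (simp add: p_def y_def ac_simps)
    moreover have "p n t = 2 * (of_int \<lfloor>y\<rfloor> + 1) / (2 * 2^n)"
      unfolding p_def y_def by (simp only: mult_divide_mult_cancel_left[of "2::real"] zero_neq_numeral[symmetric] not_False_eq_True)
    ultimately show ?thesis by (simp only:)
  qed
  have g_step: "g n t =
      (\<Sum>i<n * 2^n. G (real (Suc i) / 2^n) * indicator {real i / 2^n ..< real (Suc i) / 2^n} t)"
    for n t
  proof (cases "0 \<le> t \<and> t < real n")
    case True
    define k where "k = nat \<lfloor>t * 2^n\<rfloor>"
    have k: "real k = of_int \<lfloor>t * 2^n\<rfloor>"
      using True by (simp add: k_def)
    have ind: "t \<in> {real i / 2^n ..< real (Suc i) / 2^n} \<longleftrightarrow> i = k" for i
    proof -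
      have "t \<in> {real i / 2^n ..< real (Suc i) / 2^n} \<longleftrightarrow> real i \<le> t * 2^n \<and> t * 2^n < real i + 1"
        by (auto simp: field_simps)
      also have "\<dots> \<longleftrightarrow> \<lfloor>t * 2^n\<rfloor> = int i"
        by (auto simp: floor_eq_iff)
      also have "\<dots> \<longleftrightarrow> i = k" using k by linarith
      finally show ?thesis .
    qed
    have "real k \<le> t * 2^n" unfolding k by simp
    also have "\<dots> < real n * 2^n" using True by simp
    finally have "real k < real (n * 2^n)" by simp
    then have kn: "k < n * 2^n" by (simp only: of_nat_less_iff)
    have "(\<Sum>i<n * 2^n. G (real (Suc i) / 2^n) * indicator {real i / 2^n ..< real (Suc i) / 2^n} t)
        = (\<Sum>i<n * 2^n. if i = k then G (real (Suc i) / 2^n) else 0)"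
      by (intro sum.cong refl) (simp only: indicator_def ind split: if_split, simp)
    also have "\<dots> = G (real (Suc k) / 2^n)" using kn by simp
    also have "real (Suc k) / 2^n = p n t" using k by (simp add: p_def add.commute)
    finally show ?thesis using True by (simp add: g_def)
  next
    case False
    have "t \<notin> {real i / 2^n ..< real (Suc i) / 2^n}" if "i < n * 2^n" for i
    proof
      assume t: "t \<in> {real i / 2^n ..< real (Suc i) / 2^n}"
      have "Suc i \<le> n * 2^n" using that by simp
      then have "real (Suc i) \<le> real n * 2^n"
        by (metis of_nat_le_iff of_nat_mult of_nat_numeral of_nat_power)
      then have "real (Suc i) / 2^n \<le> real n" by (simp add: field_simps)
      moreover have "0 \<le> real i / 2^n" by simp
      moreover have "real i / 2^n \<le> t" "t < real (Suc i) / 2^n"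
        using t unfolding atLeastLessThan_iff by blast+
      ultimately have "0 \<le> t \<and> t < real n" by (meson order_trans order_less_le_trans)
      with False show False ..
    qed
    then have "(\<Sum>i<n * 2^n. G (real (Suc i) / 2^n) * indicator {real i / 2^n ..< real (Suc i) / 2^n} t)
        = 0"
      by (intro sum.neutral ballI) (simp add: indicator_def del: of_nat_Suc)
    moreover have "g n t = 0" unfolding g_def by (rule if_not_P[OF False])
    ultimately show ?thesis by (simp only:)
  qed
  have g_meas: "g n \<in> borel_measurable lborel" for n
    unfolding g_step by measurable
  have g_int: "integral\<^sup>N lborel (g n) = (\<Sum>i<n * 2^n. ennreal (1 / 2^n) * G (real (Suc i) / 2^n))" for n
  proof -
    have "integral\<^sup>N lborel (g n) = (\<Sum>i<n * 2^n. \<integral>\<^sup>+ t. G (real (Suc i) / 2^n) *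
        indicator {real i / 2^n ..< real (Suc i) / 2^n} t \<partial>lborel)"
      unfolding g_step by (rule nn_integral_sum) measurable
    also have "\<dots> = (\<Sum>i<n * 2^n. ennreal (1 / 2^n) * G (real (Suc i) / 2^n))"
    proof (rule sum.cong[OF refl])
      fix i
      have "emeasure lborel {real i / 2^n ..< real (Suc i) / 2^n} = ennreal (1 / 2^n)"
        by (subst emeasure_lborel_Ico) (auto simp: field_simps)
      then show "(\<integral>\<^sup>+ t. G (real (Suc i) / 2^n) *
          indicator {real i / 2^n ..< real (Suc i) / 2^n} t \<partial>lborel) =
          ennreal (1 / 2^n) * G (real (Suc i) / 2^n)"
        by (subst nn_integral_cmult_indicator) (auto simp: mult.commute)
    qed
    finally show ?thesis .
  qed
  have g_inc: "incseq g"
  proof (rule incseq_SucI, rule le_funI)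
    fix n t
    have "p (Suc n) t \<ge> 0" if "t \<ge> 0" using p_gt[of t "Suc n"] that by linarith
    then show "g n t \<le> g (Suc n) t"
      using anti[OF _ p_Suc[of n t]] by (auto simp: g_def)
  qed
  have g_sup: "(SUP n. g n t) = G t * indicator {0..} t" for t
  proof (cases "t \<ge> 0")
    case False
    then show ?thesis by (simp add: g_def)
  next
    case True
    have pos: "p n t \<ge> 0" for n using p_gt[of t n] True by linarith
    have p_anti: "p n t \<le> p k t" if "k \<le> n" for k n
      using that by (induction rule: dec_induct) (auto intro: order_trans[OF p_Suc])
    define D where "D = (\<lambda>n. {x. h x > ennreal (p n t)}) ` UNIV"
    have sub: "{x. h x > ennreal (p k t)} \<subseteq> {x. h x > ennreal (p n t)}" if "k \<le> n" for k n
      using p_anti[OF that] by (auto intro: le_less_trans ennreal_leI)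
    have "directed_family D"
      unfolding directed_family_def D_def
    proof (intro conjI ballI)
      fix A B
      assume "A \<in> range (\<lambda>n. {x. h x > ennreal (p n t)})" "B \<in> range (\<lambda>n. {x. h x > ennreal (p n t)})"
      then obtain i j where "A = {x. h x > ennreal (p i t)}" "B = {x. h x > ennreal (p j t)}" by auto
      then show "\<exists>C\<in>range (\<lambda>n. {x. h x > ennreal (p n t)}). A \<union> B \<subseteq> C"
        using sub[of i "max i j"] sub[of j "max i j"]
        by (intro bexI[of _ "{x. h x > ennreal (p (max i j) t)}"]) auto
    qed auto
    moreover have "\<forall>U\<in>D. open U" using op pos by (auto simp: D_def)
    ultimately have "val \<mu> (\<Union>D) = (SUP U\<in>D. val \<mu> U)"
      by (rule valuation_SUP[OF m])
    moreover have "\<Union>D = {x. h x > ennreal t}"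
    proof (intro equalityI subsetI)
      fix x assume "x \<in> \<Union>D"
      then obtain n where "h x > ennreal (p n t)" by (auto simp: D_def)
      moreover have "ennreal t \<le> ennreal (p n t)" using p_gt[of t n] by (simp add: ennreal_leI)
      ultimately show "x \<in> {x. h x > ennreal t}" by auto
    next
      fix x assume "x \<in> {x. h x > ennreal t}"
      then obtain c where c: "ennreal t < c" "c < h x" using dense by auto
      then obtain s where s: "c = ennreal s" "s \<ge> 0" by (cases c) auto
      then have "t < s" using c True by (metis ennreal_leI linorder_not_less)
      then obtain n where n: "(1/2) ^ n < s - t"
        using real_arch_pow_inv[of "s - t" "1/2"] by auto
      then have "p n t \<le> s" using p_le[of n t] by (simp add: power_divide)
      then have "ennreal (p n t) \<le> c" using s by (simp add: ennreal_leI)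
      with c(2) have "ennreal (p n t) < h x" by (rule order.strict_trans1[rotated])
      then show "x \<in> \<Union>D" by (auto simp: D_def)
    qed
    ultimately have G: "G t = (SUP n. G (p n t))"
      by (simp add: G_def D_def image_image)
    have "(SUP n. g n t) = (SUP n. G (p n t))"
    proof (rule antisym)
      show "(SUP n. g n t) \<le> (SUP n. G (p n t))"
        by (rule SUP_mono) (auto simp: g_def)
      show "(SUP n. G (p n t)) \<le> (SUP n. g n t)"
      proof (rule SUP_mono)
        fix n
        obtain N where N: "t < real N" using reals_Archimedean2 by blast
        have "G (p n t) \<le> G (p (max n N) t)"
          using anti pos p_anti[of n "max n N"] by auto
        also have "\<dots> = g (max n N) t" using N True by (auto simp: g_def)
        finally show "\<exists>k\<in>UNIV. G (p n t) \<le> g k t" by blast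
      qed
    qed
    with G True show ?thesis by simp
  qed
  have "val_integral \<mu> h = (\<integral>\<^sup>+ t. (SUP n. g n t) \<partial>lborel)"
    unfolding g_sup val_integral_def G_def ..
  also have "\<dots> = (SUP n. integral\<^sup>N lborel (g n))"
    by (rule nn_integral_monotone_convergence_SUP[OF g_inc g_meas])
  finally show ?thesis unfolding g_int G_def .
qed


section \<open>The monad\<close>

text \<open>Meaningful for continuous \<open>f\<close> only: otherwise the function need not be a valuation.\<close>

definition val_map ::
    "('a::topological_space \<Rightarrow> 'b::topological_space) \<Rightarrow> 'a valuation \<Rightarrow> 'b valuation" where
  "val_map f \<mu> = Abs_valuation (\<lambda>V. if open V then val \<mu> (f -` V) else 0)"

lemma val_val_map:
  assumes f: "continuous_on UNIV f"
  shows "val (val_map f \<mu>) V = (if open V then val \<mu> (f -` V) else 0)"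
proof -
  have op: "open (f -` V)" if "open V" for V
    using that f by (simp add: continuous_on_open_vimage)
  have m: "continuous_valuation (val \<mu>)" by (rule continuous_valuation_val)
  have "continuous_valuation (\<lambda>V. if open V then val \<mu> (f -` V) else 0)" (is "continuous_valuation ?\<nu>")
  proof (rule continuous_valuationI)
    show "?\<nu> (\<Union>D) = (SUP V\<in>D. ?\<nu> V)" if D: "directed_family D" "\<forall>V\<in>D. open V" for D
    proof -
      have "directed_family ((-`) f ` D)"
        unfolding directed_family_def
      proof (intro conjI ballI)
        fix A B assume "A \<in> (-`) f ` D" "B \<in> (-`) f ` D"
        then obtain A' B' where AB: "A' \<in> D" "B' \<in> D" "A = f -` A'" "B = f -` B'" by blast
        then obtain C' where "C' \<in> D" "A' \<union> B' \<subseteq> C'"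
          using D(1) unfolding directed_family_def by blast
        then show "\<exists>C\<in>(-`) f ` D. A \<union> B \<subseteq> C"
          using AB by (intro bexI[of _ "f -` C'"]) auto
      qed (use D in \<open>simp add: directed_family_def\<close>)
      moreover have "\<forall>U\<in>(-`) f ` D. open U"
        using D op by auto
      ultimately have "val \<mu> (\<Union>((-`) f ` D)) = (SUP U\<in>(-`) f ` D. val \<mu> U)"
        by (rule valuation_SUP[OF m])
      also have "\<dots> = (SUP V\<in>D. ?\<nu> V)"
        unfolding image_image using D by (intro SUP_cong) auto
      also have "\<Union>((-`) f ` D) = f -` \<Union>D" by auto
      finally show ?thesis using D by (simp add: open_Union)
    qed
    show "?\<nu> U + ?\<nu> V = ?\<nu> (U \<union> V) + ?\<nu> (U \<inter> V)" if "open U" "open V" for U V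
      using valuation_modular[OF m op op, OF that] that by (simp add: open_Un open_Int)
    show "?\<nu> U \<le> ?\<nu> V" if "open U" "open V" "U \<subseteq> V" for U V
      using valuation_mono[OF m op op, OF that(1,2)] that by (simp add: vimage_mono)
  qed (simp_all add: m valuation_empty)
  then show ?thesis
    unfolding val_map_def by (simp add: Abs_valuation_inverse)
qed

text \<open>The integrand is lower semi-continuous by definition of the weak topology, and the function
  of \<open>U\<close> is a continuous valuation for every \<open>\<Xi>\<close>, so that the abstraction is not vacuous.\<close>

definition val_mult :: "'a::topological_space valuation valuation \<Rightarrow> 'a valuation" where
  "val_mult \<Xi> = Abs_valuation (\<lambda>U. if open U then val_integral \<Xi> (\<lambda>\<mu>. val \<mu> U) else 0)"

definition Vw_algebra :: "('a::t0_space valuation \<Rightarrow> 'a) \<Rightarrow> bool" where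
  "Vw_algebra \<alpha> \<longleftrightarrow>
     continuous_on UNIV \<alpha> \<and> \<alpha> \<circ> dirac = id \<and> \<alpha> \<circ> val_mult = \<alpha> \<circ> val_map \<alpha>"

definition Vw_algebra_morphism ::
    "('a::t0_space valuation \<Rightarrow> 'a) \<Rightarrow> ('b::t0_space valuation \<Rightarrow> 'b) \<Rightarrow> ('a \<Rightarrow> 'b) \<Rightarrow> bool" where
  "Vw_algebra_morphism \<alpha> \<beta> f \<longleftrightarrow> continuous_on UNIV f \<and> \<beta> \<circ> val_map f = f \<circ> \<alpha>"


section \<open>Cones\<close>

definition cone_add :: "('a::t0_space valuation \<Rightarrow> 'a) \<Rightarrow> 'a \<Rightarrow> 'a \<Rightarrow> 'a" where
  "cone_add \<alpha> x y = \<alpha> (val_add (dirac x) (dirac y))"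

definition cone_scale :: "('a::t0_space valuation \<Rightarrow> 'a) \<Rightarrow> real \<Rightarrow> 'a \<Rightarrow> 'a" where
  "cone_scale \<alpha> r x = \<alpha> (val_scale r (dirac x))"

text \<open>Cones enter the following notions only through their two operations (and their topology);
  the cone axioms, which hold for \<^const>\<open>cone_add\<close> and \<^const>\<open>cone_scale\<close> of an algebra,
  are therefore not repeated as hypotheses.\<close>

definition cone_linear ::
    "('a \<Rightarrow> 'a \<Rightarrow> 'a) \<Rightarrow> (real \<Rightarrow> 'a \<Rightarrow> 'a) \<Rightarrow> ('b \<Rightarrow> 'b \<Rightarrow> 'b) \<Rightarrow> (real \<Rightarrow> 'b \<Rightarrow> 'b) \<Rightarrow>
     ('a \<Rightarrow> 'b) \<Rightarrow> bool" where
  "cone_linear add scl add' scl' f \<longleftrightarrow>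
     (\<forall>r\<ge>0. \<forall>s\<ge>0. \<forall>x y.
        f (add (scl r x) (scl s y)) = add' (scl' r (f x)) (scl' s (f y)))"

definition convex_T0 :: "('a::t0_space \<Rightarrow> 'a \<Rightarrow> 'a) \<Rightarrow> (real \<Rightarrow> 'a \<Rightarrow> 'a) \<Rightarrow> bool" where
  "convex_T0 add scl \<longleftrightarrow>
     (\<forall>a b. a \<noteq> b \<longrightarrow>
        (\<exists>\<Lambda> :: 'a \<Rightarrow> ennreal.
           lsc \<Lambda> \<and> cone_linear add scl (+) (\<lambda>r t. ennreal r * t) \<Lambda> \<and> \<Lambda> a \<noteq> \<Lambda> b))"

end

theory Submission
  imports Defs
begin

text \<open>For a lower semi-continuous linear \<open>\<Lambda>\<close> on \<open>Y\<close> and a continuous linear \<open>f\<close>, the two maps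
  \<open>\<mu> \<mapsto> \<Lambda> (f (\<alpha> \<mu>))\<close> and \<open>\<mu> \<mapsto> \<Lambda> (\<beta> (val_map f \<mu>))\<close> are lower semi-continuous, linear and agree on
  Dirac valuations. Such functionals are determined by their values on Dirac valuations (the
  uniqueness part of the Schroeder-Simpson theorem), so convex-\<open>T\<^sub>0\<close> gives \<open>f \<circ> \<alpha> = \<beta> \<circ> val_map f\<close>.

  For the uniqueness, a separation argument in finitely many coordinates shows that a functional
  \<open>\<psi>\<close> is the pointwise supremum of the step functionals \<open>\<mu> \<mapsto> \<Sum>U\<in>S. c U * \<mu> U\<close> below it. It remains
  to see that a step functional which is below \<open>\<psi>\<close> on Dirac valuations is below \<open>\<psi>\<close> everywhere.
  A bounded valuation is a finite sum of pieces each of which behaves, on finitely many prescribed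
  open sets, like a multiple of a Dirac valuation; finitely many step functionals below \<open>\<psi>\<close> are
  compared on each piece, and continuity of the valuation passes to infinitely many.\<close>

section \<open>Basic facts on valuations\<close>

lemma ennreal_add_right_imp_eq:
  fixes a b c :: ennreal
  shows "a + c = b + c \<Longrightarrow> c < top \<Longrightarrow> a = b"
  by (metis ennreal_add_diff_cancel_right less_irrefl infinity_ennreal_def)

lemma val_not_open: "\<not> open U \<Longrightarrow> val \<mu> U = 0"
  using valuation_not_open[OF continuous_valuation_val] .

lemma val_empty [simp]: "val \<mu> {} = 0"
  using valuation_empty[OF continuous_valuation_val] .

lemma val_mono: "open U \<Longrightarrow> open V \<Longrightarrow> U \<subseteq> V \<Longrightarrow> val \<mu> U \<le> val \<mu> V"
  using valuation_mono[OF continuous_valuation_val] .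

lemma val_le_UNIV: "val \<mu> U \<le> val \<mu> UNIV"
  by (cases "open U") (simp_all add: val_mono val_not_open)

lemma val_modular:
  "open U \<Longrightarrow> open V \<Longrightarrow> val \<mu> U + val \<mu> V = val \<mu> (U \<union> V) + val \<mu> (U \<inter> V)"
  using valuation_modular[OF continuous_valuation_val] .

lemma val_Union_directed:
  "directed_family D \<Longrightarrow> (\<And>U. U \<in> D \<Longrightarrow> open U) \<Longrightarrow> val \<mu> (\<Union>D) = (SUP U\<in>D. val \<mu> U)"
  using valuation_SUP[OF continuous_valuation_val] by blast

lemma directed_family_image:
  assumes D: "directed_family D" and g: "\<And>A B. A \<subseteq> B \<Longrightarrow> g A \<subseteq> g B"
  shows "directed_family (g ` D)"
  unfolding directed_family_def
proof (intro conjI ballI)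
  show "g ` D \<noteq> {}" using D by (simp add: directed_family_def)
  fix A B assume "A \<in> g ` D" "B \<in> g ` D"
  then obtain A' B' where AB: "A' \<in> D" "B' \<in> D" "A = g A'" "B = g B'" by blast
  then obtain C where C: "C \<in> D" "A' \<union> B' \<subseteq> C" using D unfolding directed_family_def by blast
  then have "A \<union> B \<subseteq> g C" using AB g[of A' C] g[of B' C] by simp
  then show "\<exists>C\<in>g ` D. A \<union> B \<subseteq> C" using C(1) by blast
qed

lemma val_Un_le: "open U \<Longrightarrow> open V \<Longrightarrow> val \<mu> (U \<union> V) \<le> val \<mu> U + val \<mu> V"
  by (simp add: val_modular)

lemma val_finite_Union_lt_top:
  assumes "finite S" "\<And>U. U \<in> S \<Longrightarrow> open U" "\<And>U. U \<in> S \<Longrightarrow> val \<mu> U < top"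
  shows "val \<mu> (\<Union>S) < top"
  using assms
proof (induction S)
  case (insert U S)
  have "val \<mu> (U \<union> \<Union>S) \<le> val \<mu> U + val \<mu> (\<Union>S)"
    using insert.prems by (intro val_Un_le open_Union) auto
  also have "\<dots> < top" using insert by (simp add: ennreal_add_less_top)
  finally show ?case by simp
qed simp

lemma val_scale_one: "val_scale 1 \<mu> = \<mu>"
  by (rule valuation_eqI) (simp add: val_val_scale)

section \<open>Continuity and basic neighbourhoods in the weak topology\<close>

lemma continuous_on_valuationI:
  assumes "\<And>U r. open U \<Longrightarrow> r \<ge> 0 \<Longrightarrow> open {x. val (g x) U > ennreal r}"
  shows "continuous_on UNIV g"
proof -
  have "open (g -` W)" if "open W" for W
    using that[unfolded open_valuation_def]
  proof (induction rule: generate_topology.induct)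
    case (UN K)
    then show ?case by (auto simp: vimage_Union)
  next
    case (Basis W)
    then show ?case using assms by (auto simp: vimage_def)
  qed auto
  then show ?thesis by (simp add: continuous_on_open_vimage)
qed

lemma continuous_on_dirac: "continuous_on UNIV dirac"
proof (rule continuous_on_valuationI)
  fix U :: "'a set" and r :: real
  assume "open U" "r \<ge> 0"
  moreover have "{x. val (dirac x) U > ennreal r} = (if r < 1 then U else {})"
    using \<open>open U\<close> \<open>r \<ge> 0\<close> by (auto simp: val_dirac ennreal_less_one_iff split: if_splits)
  ultimately show "open {x. val (dirac x) U > ennreal r}" by simp
qed

lemma continuous_on_val_map:
  assumes f: "continuous_on UNIV f"
  shows "continuous_on UNIV (val_map f)"
proof (rule continuous_on_valuationI)
  fix U :: "'b set" and r :: real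
  assume U: "open U" "r \<ge> 0"
  then have "open (f -` U)" using f by (simp add: continuous_on_open_vimage)
  then show "open {x. val (val_map f x) U > ennreal r}"
    using open_weak_subbasic U by (simp add: val_val_map[OF f])
qed

lemma lsc_compose:
  assumes "lsc h" "continuous_on UNIV g"
  shows "lsc (\<lambda>x. h (g x))"
  unfolding lsc_def
proof (intro allI impI)
  fix r :: real assume "r \<ge> 0"
  then have "open {y. h y > ennreal r}" using assms(1) by (simp add: lsc_def)
  then have "open (g -` {y. h y > ennreal r})"
    using assms(2) by (rule open_vimage)
  then show "open {x. h (g x) > ennreal r}" by (simp add: vimage_def)
qed

text \<open>Finite intersections of subbasic sets form a base. One threshold per open set is enough,
  because two thresholds for the same \<open>U\<close> combine to their maximum. Their positivity is
  what later gives \<open>R > 0\<close> in \<open>separation\<close>.\<close>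

lemma valuation_neighbourhood:
  assumes "open W" "\<mu> \<in> W"
  shows "\<exists>S r. finite S \<and> (\<forall>U\<in>S. open U \<and> 0 < r U \<and> ennreal (r U) < val \<mu> U) \<and>
           (\<forall>\<nu>. (\<forall>U\<in>S. ennreal (r U) < val \<nu> U) \<longrightarrow> \<nu> \<in> W)"
  using assms(1)[unfolded open_valuation_def] assms(2)
proof (induction rule: generate_topology.induct)
  case UNIV
  then show ?case by (intro exI[of _ "{}"]) auto
next
  case (Int A B)
  obtain S1 r1 where
    1: "finite S1" "\<forall>U\<in>S1. open U \<and> 0 < r1 U \<and> ennreal (r1 U) < val \<mu> U"
       "\<forall>\<nu>. (\<forall>U\<in>S1. ennreal (r1 U) < val \<nu> U) \<longrightarrow> \<nu> \<in> A"
    using Int.IH(1) Int.prems by blast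
  obtain S2 r2 where
    2: "finite S2" "\<forall>U\<in>S2. open U \<and> 0 < r2 U \<and> ennreal (r2 U) < val \<mu> U"
       "\<forall>\<nu>. (\<forall>U\<in>S2. ennreal (r2 U) < val \<nu> U) \<longrightarrow> \<nu> \<in> B"
    using Int.IH(2) Int.prems by blast
  \<comment> \<open>The default \<open>0\<close> outside a family leaves the maximum to the other,
    positive threshold.\<close>
  define r where
    "r U = max (if U \<in> S1 then r1 U else 0) (if U \<in> S2 then r2 U else 0)" for U
  have "\<forall>U\<in>S1 \<union> S2. open U \<and> 0 < r U \<and> ennreal (r U) < val \<mu> U"
    using 1(2) 2(2) by (auto simp: r_def max_def)
  moreover have "\<nu> \<in> A \<inter> B" if *: "\<forall>U\<in>S1 \<union> S2. ennreal (r U) < val \<nu> U" for \<nu>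
  proof -
    have "ennreal (r1 U) \<le> ennreal (r U)" if "U \<in> S1" for U
      using that by (intro ennreal_leI) (auto simp: r_def)
    moreover have "ennreal (r2 U) \<le> ennreal (r U)" if "U \<in> S2" for U
      using that by (intro ennreal_leI) (auto simp: r_def)
    ultimately show ?thesis
      using * 1(3) 2(3) by (meson IntI UnCI order.strict_trans1)
  qed
  ultimately show ?case using 1(1) 2(1) by (intro exI[of _ "S1 \<union> S2"] exI[of _ r]) auto
next
  case (UN K)
  then obtain A where A: "A \<in> K" "\<mu> \<in> A" by auto
  obtain S r where "finite S" "\<forall>U\<in>S. open U \<and> 0 < r U \<and> ennreal (r U) < val \<mu> U"
    "\<forall>\<nu>. (\<forall>U\<in>S. ennreal (r U) < val \<nu> U) \<longrightarrow> \<nu> \<in> A"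
    using UN.IH[OF A] by blast
  with A(1) show ?case by (intro exI[of _ S] exI[of _ r]) auto
next
  case (Basis W)
  then obtain U s where W: "W = {\<nu>. val \<nu> U > ennreal s}" "open U" "s \<ge> 0" by auto
  \<comment> \<open>Raising \<open>s\<close> to \<open>t\<close> shrinks the neighbourhood and makes
    the threshold positive even if \<open>s = 0\<close>.\<close>
  then obtain t where t: "t \<ge> 0" "ennreal s < ennreal t" "ennreal t < val \<mu> U"
    using Basis.prems ennreal_real_dense by blast
  then have "t > 0" using W(3) by (metis ennreal_0 le_zero_eq linorder_not_less order_le_less)
  then show ?case
    using W t by (intro exI[of _ "{U}"] exI[of _ "\<lambda>_. t"]) auto
qed


section \<open>Decomposition of bounded valuations\<close>

definition val_restrict :: "'a::topological_space set \<Rightarrow> 'a valuation \<Rightarrow> 'a valuation" where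
  "val_restrict A \<mu> = Abs_valuation (\<lambda>V. if open V then val \<mu> (V \<inter> A) else 0)"

text \<open>Intersection with \<open>A\<close> preserves unions and binary intersections, so every
  axiom is inherited from \<open>\<mu>\<close>.\<close>

lemma val_val_restrict:
  assumes A: "open A"
  shows "val (val_restrict A \<mu>) = (\<lambda>V. if open V then val \<mu> (V \<inter> A) else 0)"
proof -
  have "continuous_valuation (\<lambda>V. if open V then val \<mu> (V \<inter> A) else 0)"
    (is "continuous_valuation ?\<nu>")
  proof (rule continuous_valuationI)
    show "?\<nu> (\<Union>D) = (SUP V\<in>D. ?\<nu> V)" if D: "directed_family D" "\<forall>V\<in>D. open V" for D
    proof -
      have "directed_family ((\<lambda>V. V \<inter> A) ` D)"
        using D(1) by (rule directed_family_image) auto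
      then have "val \<mu> (\<Union>V\<in>D. V \<inter> A) = (SUP U\<in>(\<lambda>V. V \<inter> A) ` D. val \<mu> U)"
        using D A by (intro val_Union_directed) auto
      also have "\<dots> = (SUP V\<in>D. ?\<nu> V)"
        unfolding image_image using D by (intro SUP_cong) auto
      also have "(\<Union>V\<in>D. V \<inter> A) = \<Union>D \<inter> A" by auto
      finally show ?thesis using D by (simp add: open_Union)
    qed
    show "?\<nu> U + ?\<nu> V = ?\<nu> (U \<union> V) + ?\<nu> (U \<inter> V)" if "open U" "open V" for U V
    proof -
      have "(U \<inter> A) \<union> (V \<inter> A) = (U \<union> V) \<inter> A" "(U \<inter> A) \<inter> (V \<inter> A) = (U \<inter> V) \<inter> A" by auto
      then show ?thesis
        using val_modular[of "U \<inter> A" "V \<inter> A" \<mu>] that A by (simp add: open_Int open_Un)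
    qed
    show "?\<nu> U \<le> ?\<nu> V" if "open U" "open V" "U \<subseteq> V" for U V
      using that A by (auto intro!: val_mono)
  qed simp_all
  then show ?thesis
    unfolding val_restrict_def by (simp add: Abs_valuation_inverse)
qed

text \<open>The restriction of \<open>\<mu>\<close> to the complement of \<open>A\<close>; a valuation only if \<open>\<mu> A\<close> is finite.\<close>

definition val_corestrict :: "'a::topological_space set \<Rightarrow> 'a valuation \<Rightarrow> 'a valuation" where
  "val_corestrict A \<mu> = Abs_valuation (\<lambda>V. if open V then val \<mu> (V \<union> A) - val \<mu> A else 0)"

text \<open>Union with \<open>A\<close> preserves binary unions and intersections and nonempty
  directed unions. As \<open>val \<mu> A\<close> is finite, modularity and continuity can be checked
  after adding it back.\<close>

lemma val_val_corestrict:
  assumes A: "open A" and fin: "val \<mu> A < top"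
  shows "val (val_corestrict A \<mu>) = (\<lambda>V. if open V then val \<mu> (V \<union> A) - val \<mu> A else 0)"
proof -
  have le: "val \<mu> A \<le> val \<mu> (V \<union> A)" if "open V" for V
    using that A by (auto intro!: val_mono)
  have add: "val \<mu> (V \<union> A) - val \<mu> A + val \<mu> A = val \<mu> (V \<union> A)" if "open V" for V
    using le[OF that] by (simp add: diff_add_cancel_ennreal)
  have "continuous_valuation (\<lambda>V. if open V then val \<mu> (V \<union> A) - val \<mu> A else 0)"
    (is "continuous_valuation ?\<nu>")
  proof (rule continuous_valuationI)
    show "?\<nu> (\<Union>D) = (SUP V\<in>D. ?\<nu> V)" if D: "directed_family D" "\<forall>V\<in>D. open V" for D
    proof -
      have ne: "D \<noteq> {}" using D(1) by (simp add: directed_family_def)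
      have "directed_family ((\<lambda>V. V \<union> A) ` D)"
        using D(1) by (rule directed_family_image) auto
      then have "val \<mu> (\<Union>V\<in>D. V \<union> A) = (SUP U\<in>(\<lambda>V. V \<union> A) ` D. val \<mu> U)"
        using D A by (intro val_Union_directed) auto
      also have "(\<Union>V\<in>D. V \<union> A) = \<Union>D \<union> A" using ne by auto
      also have "(SUP U\<in>(\<lambda>V. V \<union> A) ` D. val \<mu> U) = (SUP V\<in>D. ?\<nu> V + val \<mu> A)"
        unfolding image_image using D add by (intro SUP_cong) auto
      also have "\<dots> = (SUP V\<in>D. ?\<nu> V) + val \<mu> A"
        using ne by (rule ennreal_SUP_add_left)
      finally have "val \<mu> (\<Union>D \<union> A) - val \<mu> A = (SUP V\<in>D. ?\<nu> V)"
        using fin by simp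
      then show ?thesis using D by (simp add: open_Union)
    qed
    show "?\<nu> U + ?\<nu> V = ?\<nu> (U \<union> V) + ?\<nu> (U \<inter> V)" if UV: "open U" "open V" for U V
    proof -
      have eq: "(U \<union> A) \<union> (V \<union> A) = (U \<union> V) \<union> A" "(U \<union> A) \<inter> (V \<union> A) = (U \<inter> V) \<union> A" by auto
      have "(?\<nu> U + ?\<nu> V) + (val \<mu> A + val \<mu> A)
          = (?\<nu> U + val \<mu> A) + (?\<nu> V + val \<mu> A)" by (simp add: ac_simps)
      also have "\<dots> = val \<mu> (U \<union> A) + val \<mu> (V \<union> A)" using UV add by simp
      also have "\<dots> = val \<mu> ((U \<union> V) \<union> A) + val \<mu> ((U \<inter> V) \<union> A)"
        using val_modular[of "U \<union> A" "V \<union> A" \<mu>] UV A unfolding eq by (simp add: open_Un)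
      also have "\<dots> = (?\<nu> (U \<union> V) + val \<mu> A) + (?\<nu> (U \<inter> V) + val \<mu> A)"
        using UV add by (simp add: open_Un open_Int)
      also have "\<dots> = (?\<nu> (U \<union> V) + ?\<nu> (U \<inter> V)) + (val \<mu> A + val \<mu> A)" by (simp add: ac_simps)
      finally show ?thesis
        by (rule ennreal_add_right_imp_eq) (use fin in \<open>simp add: ennreal_add_less_top\<close>)
    qed
    show "?\<nu> U \<le> ?\<nu> V" if "open U" "open V" "U \<subseteq> V" for U V
      using that A by (auto intro!: ennreal_minus_mono val_mono)
  \<comment> \<open>The value at the empty set is \<open>0\<close> only for finite
    \<open>val \<mu> A\<close>: in \<open>ennreal\<close>, \<open>top - top = top\<close>.\<close>
  qed (use fin in simp_all)
  then show ?thesis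
    unfolding val_corestrict_def by (simp add: Abs_valuation_inverse)
qed

text \<open>Modularity for \<open>U\<close> and \<open>A\<close>, with the finite
  \<open>val \<mu> A\<close> cancelled.\<close>

lemma val_decompose:
  assumes A: "open A" and fin: "val \<mu> A < top"
  shows "val_add (val_restrict A \<mu>) (val_corestrict A \<mu>) = \<mu>"
proof (rule valuation_eqI)
  fix U :: "'a set" assume U: "open U"
  have le: "val \<mu> A \<le> val \<mu> (U \<union> A)" using A U by (auto intro!: val_mono)
  have "val \<mu> (U \<inter> A) + (val \<mu> (U \<union> A) - val \<mu> A) + val \<mu> A
      = val \<mu> (U \<inter> A) + val \<mu> (U \<union> A)"
    using le by (simp add: add.assoc diff_add_cancel_ennreal)
  also have "\<dots> = val \<mu> U + val \<mu> A" using val_modular[OF U A, of \<mu>] by (simp add: add.commute)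
  finally have "val \<mu> (U \<inter> A) + (val \<mu> (U \<union> A) - val \<mu> A) = val \<mu> U"
    using fin by (rule ennreal_add_right_imp_eq)
  then show "val (val_add (val_restrict A \<mu>) (val_corestrict A \<mu>)) U = val \<mu> U"
    using U by (simp add: val_val_add val_val_restrict[OF A] val_val_corestrict[OF A fin])
qed

section \<open>Pieces concentrated on or off given open sets\<close>

text \<open>The mass lies entirely off \<open>A\<close> or entirely on \<open>A\<close>. Since the
  complement of \<open>A\<close> need not be open, the second case is expressed through
  intersections with \<open>A\<close>.\<close>

definition decides :: "'a::topological_space valuation \<Rightarrow> 'a set \<Rightarrow> bool" where
  "decides \<mu> A \<longleftrightarrow> val \<mu> A = 0 \<or> (\<forall>V. open V \<longrightarrow> val \<mu> (V \<inter> A) = val \<mu> V)"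

lemma decides_restrict_self:
  "open A \<Longrightarrow> decides (val_restrict A \<mu>) A"
  by (auto simp: decides_def val_val_restrict Int_assoc)

lemma decides_corestrict_self:
  "open A \<Longrightarrow> val \<mu> A < top \<Longrightarrow> decides (val_corestrict A \<mu>) A"
  by (simp add: decides_def val_val_corestrict)

text \<open>Cutting along \<open>A\<close> does not undo a decision about \<open>B\<close>, so
  finitely many sets can be treated one after the other.\<close>

lemma decides_restrict:
  assumes "open A" "open B" "decides \<mu> B"
  shows "decides (val_restrict A \<mu>) B"
proof (cases "val \<mu> B = 0")
  case True
  then have "val \<mu> (B \<inter> A) = 0"
    using val_mono[of "B \<inter> A" B \<mu>] assms by auto
  then show ?thesis using assms by (simp add: decides_def val_val_restrict)
next
  case False
  have "val \<mu> (V \<inter> B \<inter> A) = val \<mu> (V \<inter> A)" if "open V" for V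
  proof -
    have "V \<inter> B \<inter> A = (V \<inter> A) \<inter> B" by auto
    then show ?thesis using False assms that by (simp add: decides_def open_Int)
  qed
  then show ?thesis using assms by (auto simp: decides_def val_val_restrict)
qed

text \<open>If \<open>B\<close> is null, subadditivity bounds
  \<open>val \<mu> (B \<union> A)\<close> by \<open>val \<mu> A\<close>. If the mass is on
  \<open>B\<close>, open sets with the same trace on \<open>B\<close> have the same value, and
  \<open>V \<inter> B \<union> A\<close> and \<open>V \<union> A\<close> have the same
  trace.\<close>

lemma decides_corestrict:
  assumes A: "open A" "val \<mu> A < top" and B: "open B" "decides \<mu> B"
  shows "decides (val_corestrict A \<mu>) B"
proof (cases "val \<mu> B = 0")
  case True
  then have "val \<mu> (B \<union> A) \<le> val \<mu> A"
    using val_Un_le[of B A \<mu>] assms by auto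
  then have "val \<mu> (B \<union> A) - val \<mu> A = 0"
    using A(2) by (auto simp: diff_eq_0_iff_ennreal intro: order.strict_trans1)
  then show ?thesis using B by (simp add: decides_def val_val_corestrict[OF A])
next
  case False
  have conc: "val \<mu> (V \<inter> B) = val \<mu> V" if "open V" for V
    using False B that by (simp add: decides_def)
  have "val \<mu> ((V \<inter> B) \<union> A) = val \<mu> (V \<union> A)" if "open V" for V
  proof -
    have "((V \<inter> B) \<union> A) \<inter> B = (V \<union> A) \<inter> B" by auto
    then show ?thesis
      using conc[of "(V \<inter> B) \<union> A"] conc[of "V \<union> A"] that A B by (simp add: open_Int open_Un)
  qed
  then show ?thesis using B by (auto simp: decides_def val_val_corestrict[OF A])
qed

text \<open>Let \<open>I\<close> be the intersection of the members of \<open>S\<close> that carry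
  the mass and \<open>J\<close> the union of the null ones. \<open>I\<close> has full mass and
  \<open>J\<close> none, so any point of \<open>I - J\<close> serves. If there is no such point, the
  total mass is \<open>0\<close> and any point serves.\<close>

lemma decides_imp_point:
  assumes "finite S" "\<And>U. U \<in> S \<Longrightarrow> open U \<and> decides \<mu> U"
  shows "\<exists>x. \<forall>U\<in>S. val \<mu> U = (if x \<in> U then val \<mu> UNIV else 0)"
proof -
  have "\<exists>I J. open I \<and> open J \<and> val \<mu> I = val \<mu> UNIV \<and> val \<mu> J = 0 \<and>
      (\<forall>x\<in>I - J. \<forall>U\<in>S. val \<mu> U = (if x \<in> U then val \<mu> UNIV else 0))" (is "?Q S")
    using assms
  proof (induction S)
    case empty
    show ?case by (intro exI[of _ UNIV] exI[of _ "{}"]) auto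
  next
    case (insert U S)
    have "?Q S" using insert.prems by (intro insert.IH) simp
    then obtain I J where IJ: "open I" "open J" "val \<mu> I = val \<mu> UNIV" "val \<mu> J = 0"
      "\<forall>x\<in>I - J. \<forall>U\<in>S. val \<mu> U = (if x \<in> U then val \<mu> UNIV else 0)"
      by (elim exE conjE) (rule that)
    have U: "open U" "decides \<mu> U" using insert.prems by auto
    show ?case
    proof (cases "val \<mu> U = 0")
      case True
      then have "val \<mu> (J \<union> U) = 0" using val_Un_le[of J U \<mu>] IJ U by simp
      then show ?thesis
        using True IJ U by (intro exI[of _ I] exI[of _ "J \<union> U"]) auto
    next
      case False
      then have conc: "val \<mu> (V \<inter> U) = val \<mu> V" if "open V" for V
        using U that by (simp add: decides_def)
      have "val \<mu> U = val \<mu> UNIV" using conc[of UNIV] by simp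
      then show ?thesis
        using conc[of I] IJ U by (intro exI[of _ "I \<inter> U"] exI[of _ J]) auto
    qed
  qed
  then obtain I J where IJ: "open I" "open J" "val \<mu> I = val \<mu> UNIV" "val \<mu> J = 0"
    "\<And>x. x \<in> I - J \<Longrightarrow> \<forall>U\<in>S. val \<mu> U = (if x \<in> U then val \<mu> UNIV else 0)"
    by blast
  show ?thesis
  proof (cases "I \<subseteq> J")
    case True
    then have "val \<mu> UNIV = 0" using val_mono[of I J \<mu>] IJ by simp
    then have "val \<mu> U = 0" for U using val_le_UNIV[of \<mu> U] by simp
    then show ?thesis by simp
  next
    case False
    then show ?thesis using IJ(5) by blast
  qed
qed

text \<open>Cutting along each member of \<open>S\<close> in turn splits \<open>\<mu>\<close> into
  finitely many pieces that decide all of \<open>S\<close>; by \<open>decides_imp_point\<close> each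
  of them looks on \<open>S\<close> like a multiple of a Dirac valuation. Boundedness permits every
  cut.\<close>

lemma bounded_valuation_induct:
  assumes S: "finite S" "\<And>U. U \<in> S \<Longrightarrow> open U"
    and bdd: "val \<mu> UNIV < top"
    and add: "\<And>\<mu> \<nu>. P \<mu> \<Longrightarrow> P \<nu> \<Longrightarrow> P (val_add \<mu> \<nu>)"
    and point: "\<And>\<mu> x. (\<And>U. U \<in> S \<Longrightarrow> val \<mu> U = (if x \<in> U then val \<mu> UNIV else 0)) \<Longrightarrow> P \<mu>"
  shows "P \<mu>"
proof -
  \<comment> \<open>Each induction step takes the pieces that decide \<open>S\<close> and cuts them
    once more, along the new member \<open>A\<close>.\<close>
  have "P \<mu>" if "\<And>\<rho>. val \<rho> UNIV < top \<Longrightarrow> (\<And>U. U \<in> S \<Longrightarrow> decides \<rho> U) \<Longrightarrow> P \<rho>"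
    using S that
  proof (induction S)
    case empty
    then show ?case using bdd by simp
  next
    case (insert A S)
    show ?case
    proof (rule insert.IH)
      fix \<rho> :: "'a valuation"
      assume \<rho>: "val \<rho> UNIV < top" and dec: "\<And>U. U \<in> S \<Longrightarrow> decides \<rho> U"
      have A: "open A" "val \<rho> A < top"
        using insert.prems \<rho> val_le_UNIV[of \<rho> A] by (auto intro: order.strict_trans1)
      have "val (val_restrict A \<rho>) UNIV < top"
        using A by (simp add: val_val_restrict)
      moreover have "val (val_corestrict A \<rho>) UNIV < top"
        using \<rho> by (auto simp: val_val_corestrict[OF A] intro: order.strict_trans1[OF diff_le_self_ennreal])
      ultimately have "P (val_add (val_restrict A \<rho>) (val_corestrict A \<rho>))"
        using insert.prems dec A
        by (intro add insert.prems(2))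
          (auto intro: decides_restrict_self decides_restrict decides_corestrict_self decides_corestrict)
      then show "P \<rho>" by (simp add: val_decompose[OF A])
    qed (use insert.prems in auto)
  qed
  moreover have "P \<rho>" if "\<And>U. U \<in> S \<Longrightarrow> decides \<rho> U" for \<rho>
    using decides_imp_point[of S \<rho>] S that point by blast
  ultimately show ?thesis by blast
qed

text \<open>If the open subsets of \<open>U\<close> of finite mass have unbounded mass,
  \<open>\<mu>\<close> is restricted to a large one. Otherwise they do not cover \<open>U\<close>;
  every open neighbourhood of an uncovered point \<open>x\<close> of \<open>U\<close> has infinite
  mass, so every multiple of \<open>dirac x\<close> is below \<open>\<mu>\<close>.\<close>

lemma bounded_valuation_below:
  assumes U: "open U" and inf: "val \<mu> U = top" and t: "t \<ge> 0"
  shows "\<exists>\<rho>. val \<rho> UNIV < top \<and> (\<forall>V. val \<rho> V \<le> val \<mu> V) \<and> ennreal t \<le> val \<rho> U"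
proof -
  define D where "D = {A. open A \<and> A \<subseteq> U \<and> val \<mu> A < top}"
  have D: "directed_family D"
    unfolding directed_family_def
  proof (intro conjI ballI)
    show "D \<noteq> {}" by (auto simp: D_def intro!: exI[of _ "{}"])
    fix A B assume AB: "A \<in> D" "B \<in> D"
    have "val \<mu> (A \<union> B) \<le> val \<mu> A + val \<mu> B" using AB by (intro val_Un_le) (auto simp: D_def)
    also have "\<dots> < top" using AB by (simp add: D_def ennreal_add_less_top)
    finally show "\<exists>C\<in>D. A \<union> B \<subseteq> C"
      using AB by (intro bexI[of _ "A \<union> B"]) (auto simp: D_def)
  qed
  have sup: "val \<mu> (\<Union>D) = (SUP A\<in>D. val \<mu> A)"
    using D by (rule val_Union_directed) (simp add: D_def)
  show ?thesis
  proof (cases "val \<mu> (\<Union>D) = top")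
    case True
    then obtain A where A: "A \<in> D" "ennreal t < val \<mu> A"
      using sup ennreal_less_top[of t] by (metis less_SUP_iff)
    then have *: "open A" "A \<subseteq> U" "val \<mu> A < top" by (auto simp: D_def)
    have "val (val_restrict A \<mu>) V \<le> val \<mu> V" for V
      using *(1) by (auto simp: val_val_restrict intro!: val_mono)
    moreover have "U \<inter> A = A" using * by auto
    ultimately show ?thesis
      using * A U by (intro exI[of _ "val_restrict A \<mu>"]) (simp add: val_val_restrict)
  next
    case False
    have op: "open (\<Union>D)" by (rule open_Union) (simp add: D_def)
    have "\<not> U \<subseteq> \<Union>D" using val_mono[of U "\<Union>D" \<mu>] U op inf False by (auto simp: top_unique)
    then obtain x where x: "x \<in> U" "x \<notin> \<Union>D" by auto
    have "val (val_scale t (dirac x)) V \<le> val \<mu> V" for V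
    proof (cases "open V \<and> x \<in> V")
      case True
      then have "V \<inter> U \<notin> D" using x by blast
      then have "val \<mu> (V \<inter> U) = top"
        using True U by (auto simp: D_def simp flip: less_top)
      then have "val \<mu> V = top" using val_mono[of "V \<inter> U" V \<mu>] True U by (auto simp: top_unique)
      then show ?thesis by simp
    next
      case False
      then show ?thesis by (auto simp: val_val_scale val_dirac)
    qed
    then show ?thesis
      using x U by (intro exI[of _ "val_scale t (dirac x)"]) (simp add: val_val_scale val_dirac)
  qed
qed


section \<open>A theorem of the alternative\<close>

text \<open>The pairs \<open>(f x, g x)\<close> are closed under positive combinations and avoid the
  open positive quadrant, so they lie on one side of a line through the origin with nonnegative
  normal. The normal is \<open>(a, 1)\<close> if both functions take positive values, and a unit
  vector otherwise.\<close>

lemma alternative_two: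
  fixes K :: "'k set" and f g :: "'k \<Rightarrow> real"
  assumes comb: "\<And>x y p q. x \<in> K \<Longrightarrow> y \<in> K \<Longrightarrow> p > 0 \<Longrightarrow> q > 0 \<Longrightarrow>
      \<exists>z\<in>K. f z = p * f x + q * f y \<and> g z = p * g x + q * g y"
    and not_both: "\<And>x. x \<in> K \<Longrightarrow> f x \<le> 0 \<or> g x \<le> 0"
  shows "\<exists>a b. a \<ge> 0 \<and> b \<ge> 0 \<and> a + b > 0 \<and> (\<forall>x\<in>K. a * f x + b * g x \<le> 0)"
proof (cases "(\<exists>x\<in>K. f x > 0) \<and> (\<exists>y\<in>K. g y > 0)")
  case False
  then consider "\<forall>x\<in>K. f x \<le> 0" | "\<forall>x\<in>K. g x \<le> 0" by (meson not_less)
  then show ?thesis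
  proof cases
    case 1
    then show ?thesis by (intro exI[of _ 1] exI[of _ 0]) simp
  next
    case 2
    then show ?thesis by (intro exI[of _ 0] exI[of _ 1]) simp
  qed
next
  case True
  then obtain x0 where x0: "x0 \<in> K" "f x0 > 0" by auto
  \<comment> \<open>For \<open>f y < 0\<close> this compares slopes:
    \<open>g y / (- f y) \<le> - g x / f x\<close>.\<close>
  have key: "g y * f x \<le> g x * f y" if "x \<in> K" "y \<in> K" "f x > 0" "g y > 0" for x y
  proof (rule ccontr)
    \<comment> \<open>With this \<open>d\<close>, the combination of \<open>x\<close> and
      \<open>y\<close> with coefficients \<open>d - f y\<close> and \<open>f x\<close> has the
      values \<open>d * f x\<close> and \<open>d\<close>, both positive.\<close>
    define d where "d = (g y * f x - g x * f y) / (1 - g x)"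
    assume "\<not> g y * f x \<le> g x * f y"
    moreover have gx: "g x \<le> 0" and fy: "f y \<le> 0" using not_both[of x] not_both[of y] that by auto
    ultimately have d: "d > 0" by (simp add: d_def)
    have "d - f y > 0" using d fy by linarith
    then obtain z where z: "z \<in> K" "f z = (d - f y) * f x + f x * f y" "g z = (d - f y) * g x + f x * g y"
      using comb[OF \<open>x \<in> K\<close> \<open>y \<in> K\<close> _ \<open>f x > 0\<close>] by blast
    have "f z = d * f x" using z by (simp add: algebra_simps)
    then have "f z > 0" using d that by simp
    moreover have "g z = d"
      using gx by (simp add: z d_def field_simps)
    ultimately show False using not_both[OF z(1)] d by simp
  qed
  \<comment> \<open>Points with \<open>f x > 0\<close> bound the wanted \<open>a\<close> from above
    by \<open>- g x / f x\<close>, points with \<open>f x < 0 < g x\<close> from below by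
    \<open>g x / (- f x)\<close>. By \<open>key\<close>, the infimum of the upper bounds respects
    the lower ones.\<close>
  define A where "A = {- g x / f x | x. x \<in> K \<and> f x > 0}"
  define a where "a = Inf A"
  have A: "A \<noteq> {}" using x0 by (auto simp: A_def)
  have A0: "0 \<le> c" if "c \<in> A" for c
    using that not_both by (fastforce simp: A_def divide_nonpos_pos)
  have a0: "a \<ge> 0" unfolding a_def using A A0 by (rule cInf_greatest)
  have "a * f x + g x \<le> 0" if x: "x \<in> K" for x
  proof (cases "f x > 0")
    case True
    have "a \<le> - g x / f x"
      unfolding a_def using A0 True x by (intro cInf_lower bdd_belowI[of _ 0]) (auto simp: A_def)
    then show ?thesis using True by (simp add: field_simps)
  next
    case False
    show ?thesis
    proof (cases "g x > 0")
      case True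
      \<comment> \<open>Comparison with \<open>x0\<close> excludes \<open>f x = 0\<close>, where no
        \<open>a\<close> would do.\<close>
      have "g x * f x0 \<le> g x0 * f x" using key[OF x0(1) x x0(2) True] .
      moreover have "0 < g x * f x0" using True x0(2) by (rule mult_pos_pos)
      ultimately have "f x \<noteq> 0" by auto
      with False have neg: "f x < 0" by simp
      have "g x / (- f x) \<le> a"
        unfolding a_def
      proof (rule cInf_greatest[OF A])
        fix c assume "c \<in> A"
        then obtain y where y: "y \<in> K" "f y > 0" "c = - g y / f y" by (auto simp: A_def)
        then have "g y = - c * f y" by simp
        then have "g x * f y \<le> (- c * f x) * f y"
          using key[OF y(1) x y(2) True] by (simp add: ac_simps)
        then have "g x \<le> - c * f x" using y(2) by (rule mult_right_le_imp_le)
        then show "g x / (- f x) \<le> c" using neg by (simp add: field_simps)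
      qed
      then show ?thesis using neg by (simp add: field_simps)
    next
      case False
      then show ?thesis using \<open>\<not> f x > 0\<close> a0 by (simp add: add_nonpos_nonpos mult_nonneg_nonpos)
    qed
  qed
  then show ?thesis using a0 by (intro exI[of _ a] exI[of _ 1]) simp
qed

text \<open>Gordan's theorem. Since valuations do not form a vector space, \<open>K\<close> carries no linear
  structure: it suffices that the values of the functions form a convex cone.\<close>

lemma alternative_finite:
  fixes K :: "'k set" and f :: "'i \<Rightarrow> 'k \<Rightarrow> real"
  assumes "finite S" "S \<noteq> {}"
    and "\<And>x y p q. x \<in> K \<Longrightarrow> y \<in> K \<Longrightarrow> p > 0 \<Longrightarrow> q > 0 \<Longrightarrow>
      \<exists>z\<in>K. \<forall>i\<in>S. f i z = p * f i x + q * f i y"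
    and "\<And>x. x \<in> K \<Longrightarrow> \<exists>i\<in>S. f i x \<le> 0"
  shows "\<exists>a. (\<forall>i\<in>S. a i \<ge> 0) \<and> (\<exists>i\<in>S. a i > 0) \<and> (\<forall>x\<in>K. (\<Sum>i\<in>S. a i * f i x) \<le> 0)"
  using assms
proof (induction S arbitrary: K rule: finite_ne_induct)
  case (singleton j)
  then show ?case by (intro exI[of _ "\<lambda>_. 1"]) auto
next
  case (insert j S)
  \<comment> \<open>Where \<open>f j\<close> is positive, the other functions are not all positive,
    so the induction hypothesis combines them into one function. The case of two functions then
    combines this one with \<open>f j\<close>.\<close>
  define K' where "K' = {x \<in> K. f j x > 0}"
  have "\<exists>a. (\<forall>i\<in>S. a i \<ge> 0) \<and> (\<exists>i\<in>S. a i > 0) \<and> (\<forall>x\<in>K'. (\<Sum>i\<in>S. a i * f i x) \<le> 0)"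
  proof (rule insert.IH)
    fix x y p q assume xy: "x \<in> K'" "y \<in> K'" "(p::real) > 0" "(q::real) > 0"
    then obtain z where z: "z \<in> K" "\<forall>i\<in>insert j S. f i z = p * f i x + q * f i y"
      using insert.prems(1)[of x y p q] by (auto simp: K'_def)
    then have "f j z > 0" using xy by (auto simp: K'_def intro!: add_pos_pos)
    then show "\<exists>z\<in>K'. \<forall>i\<in>S. f i z = p * f i x + q * f i y"
      using z by (intro bexI[of _ z]) (auto simp: K'_def)
  next
    fix x assume "x \<in> K'"
    then show "\<exists>i\<in>S. f i x \<le> 0" using insert.prems(2)[of x] by (fastforce simp: K'_def)
  qed
  then obtain a where a: "\<forall>i\<in>S. a i \<ge> 0" "\<exists>i\<in>S. a i > 0" "\<forall>x\<in>K'. (\<Sum>i\<in>S. a i * f i x) \<le> 0"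
    by blast
  have "\<exists>b c. b \<ge> 0 \<and> c \<ge> 0 \<and> b + c > 0 \<and>
      (\<forall>x\<in>K. b * f j x + c * (\<Sum>i\<in>S. a i * f i x) \<le> 0)"
  proof (rule alternative_two)
    fix x y p q assume xy: "x \<in> K" "y \<in> K" "(p::real) > 0" "(q::real) > 0"
    then obtain z where z: "z \<in> K" "\<forall>i\<in>insert j S. f i z = p * f i x + q * f i y"
      using insert.prems(1)[of x y p q] by auto
    have "(\<Sum>i\<in>S. a i * f i z) = (\<Sum>i\<in>S. p * (a i * f i x) + q * (a i * f i y))"
      using z by (intro sum.cong) (auto simp: algebra_simps)
    then show "\<exists>z\<in>K. f j z = p * f j x + q * f j y \<and>
        (\<Sum>i\<in>S. a i * f i z) = p * (\<Sum>i\<in>S. a i * f i x) + q * (\<Sum>i\<in>S. a i * f i y)"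
      using z by (intro bexI[of _ z]) (simp_all add: sum.distrib sum_distrib_left)
  next
    fix x assume "x \<in> K"
    then show "f j x \<le> 0 \<or> (\<Sum>i\<in>S. a i * f i x) \<le> 0" using a(3) by (fastforce simp: K'_def)
  qed
  then obtain b c where bc: "b \<ge> 0" "c \<ge> 0" "b + c > 0"
    "\<forall>x\<in>K. b * f j x + c * (\<Sum>i\<in>S. a i * f i x) \<le> 0" by blast
  define e where "e i = (if i = j then b else c * a i)" for i
  have "(\<Sum>i\<in>insert j S. e i * f i x) = b * f j x + c * (\<Sum>i\<in>S. a i * f i x)" for x
  proof -
    have "(\<Sum>i\<in>S. e i * f i x) = (\<Sum>i\<in>S. c * (a i * f i x))"
      using insert.hyps by (intro sum.cong) (auto simp: e_def)
    then show ?thesis using insert.hyps by (simp add: e_def sum_distrib_left)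
  qed
  moreover have "\<exists>i\<in>insert j S. e i > 0"
  proof (cases "b > 0")
    case True
    then show ?thesis by (simp add: e_def)
  next
    case False
    then have "c > 0" using bc by simp
    then show ?thesis using a(2) insert.hyps by (auto simp: e_def)
  qed
  moreover have "\<forall>i\<in>insert j S. e i \<ge> 0" using a(1) bc by (auto simp: e_def)
  ultimately show ?case using bc(4) by (intro exI[of _ e]) simp
qed


section \<open>Lower semi-continuous linear functionals on valuations\<close>

text \<open>For open \<open>U\<close> and nonnegative \<open>c\<close>, this is the integral of the
  simple function \<open>\<Sum>U\<in>S. c U * indicator U\<close>.\<close>

definition step_value ::
    "'a::topological_space set set \<Rightarrow> ('a set \<Rightarrow> real) \<Rightarrow> 'a valuation \<Rightarrow> ennreal" where
  "step_value S c \<mu> = (\<Sum>U\<in>S. ennreal (c U) * val \<mu> U)"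

lemma step_value_add: "step_value S c (val_add \<mu> \<nu>) = step_value S c \<mu> + step_value S c \<nu>"
  by (simp add: step_value_def val_val_add distrib_left sum.distrib)

lemma step_value_ge_term:
  "finite S \<Longrightarrow> U \<in> S \<Longrightarrow> ennreal (c U) * val \<mu> U \<le> step_value S c \<mu>"
  unfolding step_value_def by (rule member_le_sum) auto

lemma step_value_point:
  assumes "\<And>U. U \<in> S \<Longrightarrow> open U"
    and "\<And>U. U \<in> S \<Longrightarrow> val \<mu> U = (if x \<in> U then val \<mu> UNIV else 0)"
  shows "step_value S c \<mu> = val \<mu> UNIV * step_value S c (dirac x)"
  unfolding step_value_def sum_distrib_left
  using assms by (intro sum.cong) (auto simp: val_dirac mult.commute)

lemma step_value_dirac:
  assumes "finite S" "\<And>U. U \<in> S \<Longrightarrow> open U \<and> 0 \<le> c U"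
  shows "step_value S c (dirac x) = ennreal (\<Sum>U | U \<in> S \<and> x \<in> U. c U)"
proof -
  have "step_value S c (dirac x) = (\<Sum>U\<in>S. if x \<in> U then ennreal (c U) else 0)"
    unfolding step_value_def using assms by (intro sum.cong) (auto simp: val_dirac)
  also have "\<dots> = (\<Sum>U | U \<in> S \<and> x \<in> U. ennreal (c U))"
    using assms(1) by (simp add: sum.inter_filter)
  also have "\<dots> = ennreal (\<Sum>U | U \<in> S \<and> x \<in> U. c U)"
    using assms(2) by (intro sum_ennreal) auto
  finally show ?thesis .
qed

text \<open>The points of the intersection of all members of \<open>S\<close> containing
  \<open>x\<close> lie in at least these members, so the value there is no smaller. The intersection
  is finite, hence open.\<close>

lemma open_step_value_dirac:
  assumes S: "finite S" "\<And>U. U \<in> S \<Longrightarrow> open U"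
  shows "open {x. ennreal t < step_value S c (dirac x)}"
proof (subst open_subopen, intro ballI)
  fix x assume x: "x \<in> {x. ennreal t < step_value S c (dirac x)}"
  define I where "I = \<Inter>{U \<in> S. x \<in> U}"
  have "open I" unfolding I_def using S by (intro open_Inter) auto
  moreover have "step_value S c (dirac x) \<le> step_value S c (dirac y)" if "y \<in> I" for y
    unfolding step_value_def using that S by (intro sum_mono mult_left_mono) (auto simp: val_dirac I_def)
  ultimately show "\<exists>T. open T \<and> x \<in> T \<and> T \<subseteq> {x. ennreal t < step_value S c (dirac x)}"
    using x by (intro exI[of _ I]) (auto simp: I_def intro: order.strict_trans2)
qed

text \<open>The restriction to \<open>\<Union>T\<close>, which is bounded by subadditivity. It
  reduces claims about finitely many open sets of finite mass to bounded valuations.\<close>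

lemma bounded_restriction:
  assumes "finite T" "\<And>U. U \<in> T \<Longrightarrow> open U" "\<And>U. U \<in> T \<Longrightarrow> val \<nu> U < top"
  shows "\<exists>\<rho>. val \<rho> UNIV < top \<and> (\<forall>V. val \<rho> V \<le> val \<nu> V) \<and>
           (\<forall>V. open V \<longrightarrow> V \<subseteq> \<Union>T \<longrightarrow> val \<rho> V = val \<nu> V)"
proof -
  have op: "open (\<Union>T)" using assms(2) by (rule open_Union[rule_format])
  have "val \<nu> (\<Union>T) < top" using assms by (rule val_finite_Union_lt_top)
  moreover have "val (val_restrict (\<Union>T) \<nu>) V \<le> val \<nu> V" for V
    using op by (auto simp: val_val_restrict[OF op] simp del: Int_Union intro!: val_mono)
  moreover have "val (val_restrict (\<Union>T) \<nu>) V = val \<nu> V" if "open V" "V \<subseteq> \<Union>T" for V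
    using that by (simp add: val_val_restrict[OF op] Int_absorb2)
  ultimately show ?thesis
    using op by (intro exI[of _ "val_restrict (\<Union>T) \<nu>"]) (simp add: val_val_restrict[OF op])
qed

lemma enn2real_linear:
  assumes "a < top" "b < top" "p \<ge> 0" "q \<ge> 0"
  shows "enn2real (ennreal p * a + ennreal q * b) = p * enn2real a + q * enn2real b"
  using assms by (simp add: enn2real_plus enn2real_mult ennreal_mult_less_top)

section \<open>Functionals as suprema of step functionals\<close>

locale lsc_linear =
  fixes \<psi> :: "'a::topological_space valuation \<Rightarrow> ennreal"
  assumes lsc: "lsc \<psi>"
    and linear: "cone_linear val_add val_scale (+) (\<lambda>r t. ennreal r * t) \<psi>"
begin

lemma combination:
  "r \<ge> 0 \<Longrightarrow> s \<ge> 0 \<Longrightarrow>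
    \<psi> (val_add (val_scale r \<mu>) (val_scale s \<nu>)) = ennreal r * \<psi> \<mu> + ennreal s * \<psi> \<nu>"
  using linear by (simp add: cone_linear_def)

lemma add: "\<psi> (val_add \<mu> \<nu>) = \<psi> \<mu> + \<psi> \<nu>"
  using combination[of 1 1 \<mu> \<nu>] by (simp add: val_scale_one)

lemma scale: "r \<ge> 0 \<Longrightarrow> \<psi> (val_scale r \<mu>) = ennreal r * \<psi> \<mu>"
proof -
  assume r: "r \<ge> 0"
  have "val_add (val_scale r \<mu>) (val_scale 0 \<mu>) = val_scale r \<mu>"
    by (rule valuation_eqI) (simp add: val_val_add val_val_scale)
  then show ?thesis using combination[OF r order_refl, of \<mu> \<mu>] by simp
qed

text \<open>Weakly open sets are upward closed in the pointwise order, because basic neighbourhoods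
  are.\<close>

lemma mono:
  assumes "\<And>U. val \<mu> U \<le> val \<nu> U"
  shows "\<psi> \<mu> \<le> \<psi> \<nu>"
proof (rule ccontr)
  assume "\<not> \<psi> \<mu> \<le> \<psi> \<nu>"
  then obtain t where t: "t \<ge> 0" "\<psi> \<nu> < ennreal t" "ennreal t < \<psi> \<mu>"
    using ennreal_real_dense by (metis not_le)
  then have "open {\<mu>. ennreal t < \<psi> \<mu>}" "\<mu> \<in> {\<mu>. ennreal t < \<psi> \<mu>}"
    using lsc by (simp_all add: lsc_def)
  from valuation_neighbourhood[OF this] obtain S r where
    "\<forall>U\<in>S. open U \<and> 0 < r U \<and> ennreal (r U) < val \<mu> U"
    "\<forall>\<nu>. (\<forall>U\<in>S. ennreal (r U) < val \<nu> U) \<longrightarrow> \<nu> \<in> {\<mu>. ennreal t < \<psi> \<mu>}"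
    by (elim exE conjE) (rule that)
  then have "\<nu> \<in> {\<mu>. ennreal t < \<psi> \<mu>}" using assms order.strict_trans2 by blast
  with t show False by simp
qed

text \<open>Positive coefficients ensure that a single \<open>U\<close> in \<open>S\<close> of
  infinite mass forces \<open>\<psi> \<mu> = top\<close>.\<close>

definition below :: "'a set set \<Rightarrow> ('a set \<Rightarrow> real) \<Rightarrow> bool" where
  "below S c \<longleftrightarrow> finite S \<and> (\<forall>U\<in>S. open U \<and> 0 < c U) \<and> (\<forall>\<mu>. step_value S c \<mu> \<le> \<psi> \<mu>)"

text \<open>Take a basic neighbourhood of \<open>\<nu>\<close>, given by \<open>S\<close> and
  \<open>r\<close>, on which \<open>\<psi>\<close> exceeds \<open>t\<close>. The vectors with
  coordinates \<open>t * v U \<mu> - r U * s \<mu>\<close> form a convex cone missing the open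
  positive orthant. The weights from Gordan's theorem, normalised, are the coefficients of the step
  functional.\<close>

lemma separation:
  assumes t: "t > 0" "ennreal t < \<psi> \<nu>"
  shows "\<exists>S c. below S c \<and> ennreal t \<le> step_value S c \<nu>"
proof -
  have "open {\<mu>. ennreal t < \<psi> \<mu>}" "\<nu> \<in> {\<mu>. ennreal t < \<psi> \<mu>}"
    using lsc t by (simp_all add: lsc_def)
  from valuation_neighbourhood[OF this] obtain S r where S: "finite S"
    and Sr: "\<forall>U\<in>S. open U \<and> 0 < r U \<and> ennreal (r U) < val \<nu> U"
    and Sn: "\<forall>\<mu>. (\<forall>U\<in>S. ennreal (r U) < val \<mu> U) \<longrightarrow> \<mu> \<in> {\<mu>. ennreal t < \<psi> \<mu>}"
    by (elim exE conjE) (rule that)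
  then have S: "finite S" "\<And>U. U \<in> S \<Longrightarrow> open U" and r: "\<And>U. U \<in> S \<Longrightarrow> 0 < r U"
    "\<And>U. U \<in> S \<Longrightarrow> ennreal (r U) < val \<nu> U" by blast+
  from Sn have nhd: "ennreal t < \<psi> \<mu>" if "\<And>U. U \<in> S \<Longrightarrow> ennreal (r U) < val \<mu> U" for \<mu>
    using that by blast
  \<comment> \<open>With no constraints, the zero valuation would satisfy
    \<open>\<psi> > t\<close>.\<close>
  have "S \<noteq> {}"
    using nhd[of "val_scale 0 \<nu>"] by (auto simp: scale)
  \<comment> \<open>Gordan's theorem concerns real values, so infinite ones are set aside here and
    recovered from bounded valuations below.\<close>
  define K where "K = {\<mu>. \<psi> \<mu> < top \<and> (\<forall>U\<in>S. val \<mu> U < top)}"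
  define v where "v U \<mu> = enn2real (val \<mu> U)" for U and \<mu> :: "'a valuation"
  define s where "s \<mu> = enn2real (\<psi> \<mu>)" for \<mu>
  have val_v: "val \<mu> U = ennreal (v U \<mu>)" if "\<mu> \<in> K" "U \<in> S" for \<mu> U
    using that by (simp add: K_def v_def)
  have \<psi>_s: "\<psi> \<mu> = ennreal (s \<mu>)" if "\<mu> \<in> K" for \<mu>
    using that by (simp add: K_def s_def)
  have v0: "v U \<mu> \<ge> 0" and s0: "s \<mu> \<ge> 0" for U \<mu>
    by (simp_all add: v_def s_def)
  have "\<exists>a. (\<forall>U\<in>S. a U \<ge> 0) \<and> (\<exists>U\<in>S. a U > 0) \<and>
      (\<forall>\<mu>\<in>K. (\<Sum>U\<in>S. a U * (t * v U \<mu> - r U * s \<mu>)) \<le> 0)"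
  proof (rule alternative_finite[OF S(1) \<open>S \<noteq> {}\<close>])
    fix \<mu> \<rho> p q assume *: "\<mu> \<in> K" "\<rho> \<in> K" "(p::real) > 0" "(q::real) > 0"
    define z where "z = val_add (val_scale p \<mu>) (val_scale q \<rho>)"
    have \<psi>z: "\<psi> z = ennreal p * \<psi> \<mu> + ennreal q * \<psi> \<rho>" using * by (simp add: z_def combination)
    have vz: "val z U = ennreal p * val \<mu> U + ennreal q * val \<rho> U" for U
      by (simp add: z_def val_val_add val_val_scale)
    have "z \<in> K" using * by (simp add: K_def \<psi>z vz ennreal_add_less_top ennreal_mult_less_top)
    moreover have "v U z = p * v U \<mu> + q * v U \<rho>" if "U \<in> S" for U
      using * that unfolding v_def vz K_def by (intro enn2real_linear) auto
    moreover have "s z = p * s \<mu> + q * s \<rho>"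
      using * unfolding s_def \<psi>z K_def by (intro enn2real_linear) auto
    ultimately show "\<exists>z\<in>K. \<forall>U\<in>S. t * v U z - r U * s z =
        p * (t * v U \<mu> - r U * s \<mu>) + q * (t * v U \<rho> - r U * s \<rho>)"
      by (intro bexI[of _ z]) (simp_all add: algebra_simps)
  next
    fix \<mu> assume \<mu>: "\<mu> \<in> K"
    show "\<exists>U\<in>S. t * v U \<mu> - r U * s \<mu> \<le> 0"
    proof (rule ccontr)
      assume "\<not> ?thesis"
      then have less: "r U * s \<mu> < t * v U \<mu>" if "U \<in> S" for U using that by force
      \<comment> \<open>Were all coordinates positive, a multiple of \<open>\<mu>\<close> would lie
        in the neighbourhood although \<open>\<psi>\<close> is at most \<open>t\<close> there: scale
        by \<open>t / s \<mu>\<close>, or by a large factor if \<open>s \<mu> = 0\<close>.\<close>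
      have "\<exists>k\<ge>0. k * s \<mu> \<le> t \<and> (\<forall>U\<in>S. r U < k * v U \<mu>)"
      proof (cases "s \<mu> = 0")
        case False
        then have "s \<mu> > 0" using s0[of \<mu>] by simp
        then show ?thesis
          using less t by (intro exI[of _ "t / s \<mu>"]) (auto simp: field_simps)
      next
        case True
        then have vpos: "v U \<mu> > 0" if "U \<in> S" for U
          using less[OF that] t by (simp add: zero_less_mult_iff)
        \<comment> \<open>The sum dominates each quotient; the \<open>+ 1\<close> gives the strict
          inequality.\<close>
        define k where "k = (\<Sum>U\<in>S. (r U + 1) / v U \<mu>)"
        have nn: "0 \<le> (r U + 1) / v U \<mu>" if "U \<in> S" for U
          using vpos[OF that] r(1)[OF that] by simp
        have "r U < k * v U \<mu>" if "U \<in> S" for U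
        proof -
          have "(r U + 1) / v U \<mu> \<le> k"
            unfolding k_def using that nn S(1) by (intro member_le_sum) auto
          then show ?thesis using vpos[OF that] by (simp add: field_simps)
        qed
        moreover have "k \<ge> 0" unfolding k_def using nn by (rule sum_nonneg)
        ultimately show ?thesis using True t by (intro exI[of _ k]) auto
      qed
      then obtain k where k: "k \<ge> 0" "k * s \<mu> \<le> t" "\<And>U. U \<in> S \<Longrightarrow> r U < k * v U \<mu>" by blast
      have "ennreal t < \<psi> (val_scale k \<mu>)"
      proof (rule nhd)
        fix U assume U: "U \<in> S"
        show "ennreal (r U) < val (val_scale k \<mu>) U"
          using k(1) k(3)[OF U] r(1)[OF U] v0[of U \<mu>]
          by (simp add: val_val_scale val_v[OF \<mu> U] ennreal_mult[symmetric] ennreal_less_iff)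
      qed
      also have "\<psi> (val_scale k \<mu>) = ennreal (k * s \<mu>)"
        using k(1) s0[of \<mu>] by (simp add: scale \<psi>_s[OF \<mu>] ennreal_mult)
      also have "\<dots> \<le> ennreal t" using k(2) by (rule ennreal_leI)
      finally show False by simp
    qed
  qed
  then obtain a where a: "\<And>U. U \<in> S \<Longrightarrow> a U \<ge> 0" "\<exists>U\<in>S. a U > 0"
    "\<And>\<mu>. \<mu> \<in> K \<Longrightarrow> (\<Sum>U\<in>S. a U * (t * v U \<mu> - r U * s \<mu>)) \<le> 0" by blast
  define R where "R = (\<Sum>U\<in>S. a U * r U)"
  obtain U0 where "U0 \<in> S" "a U0 > 0" using a(2) by blast
  then have R: "R > 0"
    unfolding R_def using a(1) r(1) S(1)
    by (intro sum_pos2[of S U0]) (auto intro!: mult_nonneg_nonneg mult_pos_pos less_imp_le[of 0 "r _"])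
  \<comment> \<open>Sets of weight \<open>0\<close> are dropped, as \<open>below\<close> asks for
    positive coefficients.\<close>
  define T where "T = {U \<in> S. a U > 0}"
  \<comment> \<open>Normalised so that the \<open>c U * r U\<close> sum up to \<open>t\<close>, the
    bound wanted at \<open>\<nu>\<close>.\<close>
  define c where "c U = t * a U / R" for U
  have T: "finite T" "T \<subseteq> S" using S by (auto simp: T_def)
  have c: "c U > 0" if "U \<in> T" for U using that t R by (simp add: c_def T_def)
  have sum_T: "(\<Sum>U\<in>T. c U * g U) = (\<Sum>U\<in>S. a U * g U) * (t / R)" for g
  proof -
    have "(\<Sum>U\<in>T. c U * g U) = (\<Sum>U\<in>S. c U * g U)"
      using S(1) a(1) T(2) by (intro sum.mono_neutral_left) (auto simp: T_def c_def order_le_less)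
    also have "\<dots> = (\<Sum>U\<in>S. a U * g U * (t / R))"
      by (intro sum.cong) (simp_all add: c_def)
    finally show ?thesis by (simp only: sum_distrib_right)
  qed
  have K_le: "step_value T c \<mu> \<le> \<psi> \<mu>" if \<mu>: "\<mu> \<in> K" for \<mu>
  proof -
    have "step_value T c \<mu> = (\<Sum>U\<in>T. ennreal (c U * v U \<mu>))"
      unfolding step_value_def using T c \<mu> v0
      by (intro sum.cong) (auto simp: val_v ennreal_mult less_imp_le subset_iff)
    also have "\<dots> = ennreal (\<Sum>U\<in>T. c U * v U \<mu>)"
      using c v0 by (intro sum_ennreal mult_nonneg_nonneg) (auto intro: less_imp_le)
    also have "(\<Sum>U\<in>T. c U * v U \<mu>) \<le> s \<mu>"
    proof -
      have "(\<Sum>U\<in>S. a U * (t * v U \<mu> - r U * s \<mu>)) = (\<Sum>U\<in>S. a U * v U \<mu>) * t - R * s \<mu>"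
        by (simp add: R_def algebra_simps sum_subtractf sum_distrib_left sum_distrib_right)
      then have "(\<Sum>U\<in>S. a U * v U \<mu>) * t \<le> R * s \<mu>" using a(3)[OF \<mu>] by simp
      then show ?thesis unfolding sum_T using R by (simp add: field_simps)
    qed
    then have "ennreal (\<Sum>U\<in>T. c U * v U \<mu>) \<le> ennreal (s \<mu>)" by (rule ennreal_leI)
    finally show ?thesis using \<psi>_s[OF \<mu>] by simp
  qed
  \<comment> \<open>If \<open>\<psi> \<mu>\<close> is finite, all members of \<open>T\<close> have
    finite mass, and the restriction to \<open>\<Union>T\<close> lies in \<open>K\<close> with the
    same step value.\<close>
  have "step_value T c \<mu> \<le> \<psi> \<mu>" for \<mu>
  proof (cases "\<psi> \<mu> = top")
    case False
    then have fin: "\<psi> \<mu> < top" by (simp add: less_top)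
    have in_K: "\<rho> \<in> K" if "val \<rho> UNIV < top" "\<forall>V. val \<rho> V \<le> val \<mu> V" for \<rho>
      using that fin mono[of \<rho> \<mu>] val_le_UNIV[of \<rho>]
      unfolding K_def by (auto intro: order.strict_trans1)
    have fin_T: "val \<mu> U < top" if U: "U \<in> T" for U
    proof (rule ccontr)
      assume "\<not> val \<mu> U < top"
      then have "val \<mu> U = top" by (simp flip: less_top)
      \<comment> \<open>This mass makes the term of \<open>U\<close> alone exceed
        \<open>\<psi> \<mu>\<close>.\<close>
      then obtain \<rho> where \<rho>: "val \<rho> UNIV < top" "\<forall>V. val \<rho> V \<le> val \<mu> V"
        "ennreal ((s \<mu> + 1) / c U) \<le> val \<rho> U"
        using bounded_valuation_below[of U \<mu> "(s \<mu> + 1) / c U"] U T S(2) c[OF U] s0[of \<mu>] by auto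
      have "ennreal (s \<mu> + 1) = ennreal (c U) * ennreal ((s \<mu> + 1) / c U)"
        using c[OF U] s0[of \<mu>] by (simp flip: ennreal_mult)
      also have "\<dots> \<le> ennreal (c U) * val \<rho> U" using \<rho>(3) by (rule mult_left_mono) simp
      also have "\<dots> \<le> step_value T c \<rho>" using T U by (intro step_value_ge_term)
      also have "\<dots> \<le> \<psi> \<rho>" using in_K[OF \<rho>(1,2)] by (rule K_le)
      also have "\<dots> \<le> \<psi> \<mu>" using \<rho>(2) by (intro mono) simp
      also have "\<psi> \<mu> = ennreal (s \<mu>)" using fin by (simp add: s_def)
      finally show False using s0[of \<mu>] by simp
    qed
    then obtain \<rho> where \<rho>: "val \<rho> UNIV < top" "\<forall>V. val \<rho> V \<le> val \<mu> V"
      "\<forall>V. open V \<longrightarrow> V \<subseteq> \<Union>T \<longrightarrow> val \<rho> V = val \<mu> V"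
      using bounded_restriction[of T \<mu>] T S(2) by blast
    have "step_value T c \<mu> = step_value T c \<rho>"
      unfolding step_value_def using \<rho>(3) T(2) S(2) by (intro sum.cong) (auto simp: Sup_upper)
    also have "\<dots> \<le> \<psi> \<rho>" using in_K[OF \<rho>(1,2)] by (rule K_le)
    also have "\<dots> \<le> \<psi> \<mu>" using \<rho>(2) by (intro mono) simp
    finally show ?thesis .
  qed simp
  then have "below T c" using T S(2) c by (auto simp: below_def)
  moreover have "ennreal t \<le> step_value T c \<nu>"
  proof -
    have "t = (\<Sum>U\<in>T. c U * r U)" unfolding sum_T using R by (simp add: R_def)
    also have "ennreal \<dots> = (\<Sum>U\<in>T. ennreal (c U) * ennreal (r U))"
      using c r(1) T(2) by (subst sum_ennreal[symmetric])
        (auto simp: ennreal_mult less_imp_le subset_iff intro!: mult_nonneg_nonneg)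
    also have "\<dots> \<le> step_value T c \<nu>"
      unfolding step_value_def using r(2) T(2)
      by (intro sum_mono mult_left_mono) (auto intro: less_imp_le)
    finally show ?thesis .
  qed
  ultimately show ?thesis by blast
qed

section \<open>From Dirac valuations to all valuations\<close>

text \<open>An infinite mass on one of the sets involved makes \<open>\<psi> \<nu>\<close> infinite.
  Otherwise \<open>\<nu>\<close> is restricted to their union and split into pieces that look like
  multiples of Dirac valuations on \<open>V\<close> and all these sets.\<close>

lemma scaled_val_le_of_finite_cover:
  assumes F: "finite F" "\<And>S c. (S, c) \<in> F \<Longrightarrow> below S c"
    and V: "open V"
    and cover: "\<And>x. x \<in> V \<Longrightarrow> \<exists>(S, c)\<in>F. ennreal t < step_value S c (dirac x)"
  shows "ennreal t * val \<nu> V \<le> \<psi> \<nu>"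
proof (cases "\<exists>(S, c)\<in>F. \<exists>U\<in>S. val \<nu> U = top")
  case True
  then obtain S c U where *: "(S, c) \<in> F" "U \<in> S" "val \<nu> U = top" by blast
  then have b: "below S c" using F by blast
  then have "0 < c U" using *(2) by (simp add: below_def)
  then have "top \<le> ennreal (c U) * val \<nu> U" using *(3) by (simp add: ennreal_mult_top)
  also have "\<dots> \<le> step_value S c \<nu>" using * b by (intro step_value_ge_term) (auto simp: below_def)
  also have "\<dots> \<le> \<psi> \<nu>" using b by (simp add: below_def)
  finally show ?thesis by (simp add: top_unique)
next
  case False
  define T where "T = \<Union>(fst ` F)"
  have T: "finite T" using F by (auto simp: T_def below_def)
  have T_open: "open U" if "U \<in> T" for U
    using that F(2) by (fastforce simp: T_def below_def)
  have T_fin: "val \<nu> U < top" if "U \<in> T" for U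
    using that False by (fastforce simp: T_def less_top)
  have sub: "V \<subseteq> \<Union>T"
  proof
    fix x assume "x \<in> V"
    then obtain S c where Sc: "(S, c) \<in> F" "ennreal t < step_value S c (dirac x)"
      using cover by blast
    have "\<exists>U\<in>S. x \<in> U"
    proof (rule ccontr)
      assume "\<not> ?thesis"
      then have "step_value S c (dirac x) = 0"
        unfolding step_value_def by (intro sum.neutral) (auto simp: val_dirac)
      with Sc show False by simp
    qed
    then show "x \<in> \<Union>T" using Sc(1) by (force simp: T_def)
  qed
  obtain \<rho> where \<rho>: "val \<rho> UNIV < top" "\<forall>V. val \<rho> V \<le> val \<nu> V"
    "\<forall>V. open V \<longrightarrow> V \<subseteq> \<Union>T \<longrightarrow> val \<rho> V = val \<nu> V"
    using bounded_restriction[OF T T_open T_fin] by blast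
  have "ennreal t * val \<rho> V \<le> \<psi> \<rho>"
  proof (rule bounded_valuation_induct[of "insert V T" \<rho>])
    fix \<mu> \<mu>' assume "ennreal t * val \<mu> V \<le> \<psi> \<mu>" "ennreal t * val \<mu>' V \<le> \<psi> \<mu>'"
    then show "ennreal t * val (val_add \<mu> \<mu>') V \<le> \<psi> (val_add \<mu> \<mu>')"
      by (simp add: val_val_add add distrib_left add_mono)
  next
    fix \<mu> :: "'a valuation" and x
    assume point: "\<And>U. U \<in> insert V T \<Longrightarrow> val \<mu> U = (if x \<in> U then val \<mu> UNIV else 0)"
    show "ennreal t * val \<mu> V \<le> \<psi> \<mu>"
    proof (cases "x \<in> V")
      case True
      \<comment> \<open>The step functional depends on the point of the piece; different pieces may
        use different members of \<open>F\<close>.\<close>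
      then obtain S c where Sc: "(S, c) \<in> F" "ennreal t < step_value S c (dirac x)"
        using cover by blast
      have ST: "S \<subseteq> T" using Sc(1) by (force simp: T_def)
      have "ennreal t * val \<mu> V = val \<mu> UNIV * ennreal t"
        using True point[of V] by (simp add: mult.commute)
      also have "\<dots> \<le> val \<mu> UNIV * step_value S c (dirac x)"
        using Sc(2) by (intro mult_left_mono) auto
      also have "\<dots> = step_value S c \<mu>"
        using ST T_open by (intro step_value_point[symmetric] point) auto
      also have "\<dots> \<le> \<psi> \<mu>" using F(2)[OF Sc(1)] by (simp add: below_def)
      finally show ?thesis .
    next
      case False
      then have "val \<mu> V = 0" using point[of V] by simp
      then show ?thesis by simp
    qed
  qed (use T T_open V \<rho>(1) in auto)
  also have "val \<rho> V = val \<nu> V" using \<rho>(3) V sub by blast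
  also have "\<psi> \<rho> \<le> \<psi> \<nu>" using \<rho>(2) by (intro mono) simp
  finally show ?thesis .
qed

text \<open>By \<open>separation\<close>, \<open>V\<close> is covered by open sets on each of which
  one step functional below \<open>\<psi>\<close> exceeds \<open>t\<close> at Dirac valuations. The
  traces on \<open>V\<close> of finite unions of such sets are directed, so continuity of
  \<open>\<nu>\<close> passes from finite covers to \<open>V\<close>.\<close>

lemma scaled_val_le:
  assumes V: "open V" and t: "t > 0" and less: "\<And>x. x \<in> V \<Longrightarrow> ennreal t < \<psi> (dirac x)"
  shows "ennreal t * val \<nu> V \<le> \<psi> \<nu>"
proof -
  define N where "N S c = {x. ennreal t < step_value S c (dirac x)}" for S and c :: "'a set \<Rightarrow> real"
  define W where "W F = V \<inter> (\<Union>(S, c)\<in>F. N S c)" for F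
  define \<F> where "\<F> = {F. finite F \<and> (\<forall>(S, c)\<in>F. below S c)}"
  have N_open: "open (N S c)" if "below S c" for S c
    unfolding N_def using that by (intro open_step_value_dirac) (auto simp: below_def)
  have W_open: "open (W F)" if "F \<in> \<F>" for F
    unfolding W_def using that V N_open by (intro open_Int open_UN) (auto simp: \<F>_def)
  have "directed_family (W ` \<F>)"
    unfolding directed_family_def
  proof (intro conjI ballI)
    show "W ` \<F> \<noteq> {}" by (auto simp: \<F>_def intro!: exI[of _ "{}"])
    fix A B assume "A \<in> W ` \<F>" "B \<in> W ` \<F>"
    then obtain F G where FG: "F \<in> \<F>" "G \<in> \<F>" "A = W F" "B = W G" by blast
    then have "F \<union> G \<in> \<F>" by (auto simp: \<F>_def)
    moreover have "A \<union> B \<subseteq> W (F \<union> G)" using FG by (auto simp: W_def)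
    ultimately show "\<exists>C\<in>W ` \<F>. A \<union> B \<subseteq> C" by blast
  qed
  then have "val \<nu> (\<Union>(W ` \<F>)) = (SUP A\<in>W ` \<F>. val \<nu> A)"
    using W_open by (intro val_Union_directed) auto
  also have "\<Union>(W ` \<F>) = V"
  proof
    show "V \<subseteq> \<Union>(W ` \<F>)"
    proof
      fix x assume x: "x \<in> V"
      \<comment> \<open>The room between \<open>t\<close> and \<open>t'\<close> turns the weak bound
        of \<open>separation\<close> into a strict one.\<close>
      obtain t' where t': "ennreal t < ennreal t'" "ennreal t' < \<psi> (dirac x)"
        using ennreal_real_dense[OF less[OF x]] by blast
      then have "t' > 0" using t by (metis ennreal_le_iff2 less_eq_real_def not_le order.strict_trans)
      then obtain S c where Sc: "below S c" "ennreal t' \<le> step_value S c (dirac x)"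
        using separation t'(2) by blast
      then have "{(S, c)} \<in> \<F>" "x \<in> W {(S, c)}"
        using x t'(1) by (auto simp: \<F>_def W_def N_def intro: order.strict_trans2)
      then show "x \<in> \<Union>(W ` \<F>)" by blast
    qed
  qed (auto simp: W_def)
  finally have "ennreal t * val \<nu> V = (SUP F\<in>\<F>. ennreal t * val \<nu> (W F))"
    by (simp add: image_image SUP_mult_left_ennreal)
  also have "\<dots> \<le> \<psi> \<nu>"
  proof (rule SUP_least)
    fix F assume F: "F \<in> \<F>"
    show "ennreal t * val \<nu> (W F) \<le> \<psi> \<nu>"
    proof (rule scaled_val_le_of_finite_cover[OF _ _ W_open[OF F]])
      show "\<exists>(S, c)\<in>F. ennreal t < step_value S c (dirac x)" if "x \<in> W F" for x
        using that by (auto simp: W_def N_def)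
    qed (use F in \<open>auto simp: \<F>_def\<close>)
  qed
  finally show ?thesis .
qed

text \<open>On a piece at \<open>x\<close>, the step functional is the mass times the sum of
  \<open>c\<close> over the members containing \<open>x\<close>. A factor
  \<open>\<theta> < 1\<close> makes the bound at \<open>dirac x\<close> strict, hence valid on an
  open set of full mass, to which \<open>scaled_val_le\<close> applies. At the end
  \<open>\<theta>\<close> tends to \<open>1\<close>.\<close>

lemma step_value_le:
  assumes S: "finite S" "\<And>U. U \<in> S \<Longrightarrow> open U" and c: "\<And>U. U \<in> S \<Longrightarrow> 0 < c U"
    and le: "\<And>x. step_value S c (dirac x) \<le> \<psi> (dirac x)"
  shows "step_value S c \<nu> \<le> \<psi> \<nu>"
proof (cases "\<exists>U\<in>S. val \<nu> U = top")
  case True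
  then obtain U where U: "U \<in> S" "val \<nu> U = top" by blast
  \<comment> \<open>Halving gives the strict inequality required by \<open>scaled_val_le\<close>;
    any positive multiple of \<open>top\<close> is \<open>top\<close>.\<close>
  have "ennreal (c U / 2) * val \<nu> U \<le> \<psi> \<nu>"
  proof (rule scaled_val_le)
    fix x assume x: "x \<in> U"
    have "ennreal (c U / 2) < ennreal (c U)" using c[OF U(1)] by (simp add: ennreal_less_iff)
    also have "\<dots> = ennreal (c U) * val (dirac x) U" using x U S by (simp add: val_dirac)
    also have "\<dots> \<le> step_value S c (dirac x)" using S U by (intro step_value_ge_term)
    also have "\<dots> \<le> \<psi> (dirac x)" by (rule le)
    finally show "ennreal (c U / 2) < \<psi> (dirac x)" .
  qed (use U S c in auto)
  then have "\<psi> \<nu> = top" using U c[OF U(1)] by (simp add: ennreal_mult_top top_unique)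
  then show ?thesis by simp
next
  case False
  then have "val \<nu> U < top" if "U \<in> S" for U using that by (simp add: less_top)
  then obtain \<rho> where \<rho>: "val \<rho> UNIV < top" "\<forall>V. val \<rho> V \<le> val \<nu> V"
    "\<forall>V. open V \<longrightarrow> V \<subseteq> \<Union>S \<longrightarrow> val \<rho> V = val \<nu> V"
    using bounded_restriction[of S \<nu>] S by blast
  have scaled: "ennreal \<theta> * step_value S c \<rho> \<le> \<psi> \<rho>" if \<theta>: "0 < \<theta>" "\<theta> < 1" for \<theta>
  proof -
    define V where "V T = {x. ennreal (\<theta> * sum c T) < \<psi> (dirac x)}" for T
    have V_open: "open (V T)" if "T \<subseteq> S" for T
    proof -
      have "0 \<le> \<theta> * sum c T"
        using \<theta> c that by (intro mult_nonneg_nonneg sum_nonneg) (auto intro: less_imp_le)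
      then show ?thesis
        using lsc_compose[OF lsc continuous_on_dirac] by (simp add: V_def lsc_def)
    qed
    \<comment> \<open>Cutting also along every \<open>V T\<close> ensures that a piece at a point of
      \<open>V T\<close> gives this set its full mass.\<close>
    show ?thesis
    proof (rule bounded_valuation_induct[of "S \<union> V ` Pow S" \<rho>])
      fix \<mu> \<mu>' assume "ennreal \<theta> * step_value S c \<mu> \<le> \<psi> \<mu>" "ennreal \<theta> * step_value S c \<mu>' \<le> \<psi> \<mu>'"
      then show "ennreal \<theta> * step_value S c (val_add \<mu> \<mu>') \<le> \<psi> (val_add \<mu> \<mu>')"
        by (simp add: step_value_add add distrib_left add_mono)
    next
      fix \<mu> :: "'a valuation" and x
      assume point: "\<And>U. U \<in> S \<union> V ` Pow S \<Longrightarrow> val \<mu> U = (if x \<in> U then val \<mu> UNIV else 0)"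
      define T where "T = {U. U \<in> S \<and> x \<in> U}"
      have T: "T \<subseteq> S" "finite T" using S by (auto simp: T_def)
      have dx: "step_value S c (dirac x) = ennreal (sum c T)"
        using S c by (simp add: step_value_dirac T_def less_imp_le)
      have "step_value S c \<mu> = val \<mu> UNIV * step_value S c (dirac x)"
        using S by (intro step_value_point point) auto
      then have \<mu>: "step_value S c \<mu> = val \<mu> UNIV * ennreal (sum c T)" using dx by simp
      show "ennreal \<theta> * step_value S c \<mu> \<le> \<psi> \<mu>"
      proof (cases "T = {}")
        case True
        then show ?thesis by (simp add: \<mu>)
      next
        case False
        then have pos: "sum c T > 0" using T c by (intro sum_pos) auto
        have "ennreal (\<theta> * sum c T) < ennreal (sum c T)"
          using pos \<theta> by (simp add: ennreal_less_iff)
        also have "\<dots> \<le> \<psi> (dirac x)" using le[of x] dx by simp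
        finally have "x \<in> V T" by (simp add: V_def)
        then have "val \<mu> (V T) = val \<mu> UNIV" using point[of "V T"] T by simp
        then have "ennreal \<theta> * step_value S c \<mu> = ennreal (\<theta> * sum c T) * val \<mu> (V T)"
          using pos \<theta> by (simp add: \<mu> ennreal_mult ac_simps)
        also have "\<dots> \<le> \<psi> \<mu>"
          using V_open[OF T(1)] pos \<theta> by (intro scaled_val_le) (auto simp: V_def)
        finally show ?thesis .
      qed
    qed (use S V_open \<rho>(1) in auto)
  qed
  have "step_value S c \<rho> \<le> \<psi> \<rho>"
  proof (cases "\<psi> \<rho> = top")
    case False
    then obtain b where b: "\<psi> \<rho> = ennreal b" "b \<ge> 0" by (cases "\<psi> \<rho>") auto
    have "val \<rho> U < top" for U using \<rho>(1) val_le_UNIV[of \<rho> U] by (rule order.strict_trans1[rotated])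
    then have "step_value S c \<rho> < top"
      using S by (simp add: step_value_def ennreal_mult_less_top less_top)
    then obtain a where a: "step_value S c \<rho> = ennreal a" "a \<ge> 0"
      by (cases "step_value S c \<rho>") auto
    \<comment> \<open>Both sides are finite, so \<open>\<theta>\<close> can tend to \<open>1\<close>
      in the reals.\<close>
    have "a \<le> b"
    proof (rule field_le_mult_one_interval)
      fix \<theta> :: real assume \<theta>: "0 < \<theta>" "\<theta> < 1"
      then have "ennreal (\<theta> * a) \<le> ennreal b" using scaled[OF \<theta>] a b by (simp add: ennreal_mult)
      then show "\<theta> * a \<le> b" using b(2) by simp
    qed
    then show ?thesis using a b by (simp add: ennreal_leI)
  qed simp
  moreover have "step_value S c \<rho> = step_value S c \<nu>"
    unfolding step_value_def using \<rho>(3) S(2) by (intro sum.cong) (auto simp: Sup_upper)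
  moreover have "\<psi> \<rho> \<le> \<psi> \<nu>" using \<rho>(2) by (intro mono) simp
  ultimately show ?thesis by simp
qed

end

text \<open>If \<open>\<phi> \<nu>\<close> exceeded \<open>\<psi> \<nu>\<close>, so would some step
  functional below \<open>\<phi>\<close>; but that one is below \<open>\<psi>\<close> on Dirac
  valuations, hence everywhere.\<close>

lemma lsc_linear_le:
  assumes "lsc_linear \<phi>" "lsc_linear \<psi>" and le: "\<And>x. \<phi> (dirac x) \<le> \<psi> (dirac x)"
  shows "\<phi> \<nu> \<le> \<psi> \<nu>"
proof (rule ccontr)
  assume "\<not> \<phi> \<nu> \<le> \<psi> \<nu>"
  then have "\<psi> \<nu> < \<phi> \<nu>" by (simp add: not_le)
  then obtain t where t: "t \<ge> 0" "\<psi> \<nu> < ennreal t" "ennreal t < \<phi> \<nu>"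
    using ennreal_real_dense by blast
  then have "t > 0" by (cases "t = 0") auto
  then obtain S c where b: "lsc_linear.below \<phi> S c" and ge: "ennreal t \<le> step_value S c \<nu>"
    using lsc_linear.separation[OF assms(1)] t(3) by blast
  note b = b[unfolded lsc_linear.below_def[OF assms(1)]]
  have S: "finite S" "\<And>U. U \<in> S \<Longrightarrow> open U" "\<And>U. U \<in> S \<Longrightarrow> 0 < c U" using b by blast+
  have "step_value S c (dirac x) \<le> \<psi> (dirac x)" for x
  proof -
    have "step_value S c (dirac x) \<le> \<phi> (dirac x)" using b by blast
    also have "\<dots> \<le> \<psi> (dirac x)" by (rule le)
    finally show ?thesis .
  qed
  with assms(2) S have "step_value S c \<nu> \<le> \<psi> \<nu>"
    by (rule lsc_linear.step_value_le)
  with ge t(2) show False by simp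
qed

text \<open>The uniqueness part of the Schroeder-Simpson theorem.\<close>

lemma lsc_linear_eqI:
  assumes "lsc_linear \<phi>" "lsc_linear \<psi>" "\<And>x. \<phi> (dirac x) = \<psi> (dirac x)"
  shows "\<phi> \<nu> = \<psi> \<nu>"
proof (rule antisym)
  show "\<phi> \<nu> \<le> \<psi> \<nu>" using assms(1,2) by (rule lsc_linear_le) (simp add: assms(3))
  show "\<psi> \<nu> \<le> \<phi> \<nu>" using assms(2,1) by (rule lsc_linear_le) (simp add: assms(3))
qed


section \<open>Algebra maps are linear\<close>

text \<open>The length of \<open>[0, a)\<close>, for \<open>a = top\<close> that of the half-line;
  it evaluates integrals against Dirac valuations.\<close>

lemma nn_integral_less_ennreal: "(\<integral>\<^sup>+ r\<in>{0..}. indicator {r. ennreal r < a} r \<partial>lborel) = a"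
proof -
  have "(\<integral>\<^sup>+ r\<in>{0..}. indicator {r. ennreal r < a} r \<partial>lborel) =
      (\<integral>\<^sup>+ r. indicator {r. 0 \<le> r \<and> ennreal r < a} r \<partial>lborel)"
    by (intro nn_integral_cong) (auto simp: indicator_def)
  also have "\<dots> = a"
  proof (cases a)
    case (real b)
    then have "{r. 0 \<le> r \<and> ennreal r < a} = {0..<b}" by (auto simp: ennreal_less_iff)
    then show ?thesis using real by simp
  next
    case top
    then have "{r. 0 \<le> r \<and> ennreal r < a} = {0..}" by auto
    moreover have "emeasure lborel {0::real..} = top"
    proof (rule ccontr)
      assume "emeasure lborel {0::real..} \<noteq> top"
      then obtain b where b: "emeasure lborel {0::real..} = ennreal b" "b \<ge> 0"
        by (cases "emeasure lborel {0::real..}") auto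
      have "emeasure lborel {0..<b + 1} \<le> emeasure lborel {0::real..}"
        by (rule emeasure_mono) auto
      then show False using b by simp
    qed
    ultimately show ?thesis using top by simp
  qed
  finally show ?thesis .
qed

lemma val_dirac_greater:
  assumes "open U" "r \<ge> 0"
  shows "val (dirac \<mu>) {\<rho>. val \<rho> U > ennreal r} = indicator {r. ennreal r < val \<mu> U} r"
  using open_weak_subbasic[OF assms] by (simp add: val_dirac indicator_def)

text \<open>For a combination of two Dirac valuations, the function of the level \<open>r\<close>
  being integrated is the same combination of two indicators.\<close>

lemma val_integral_combination:
  assumes U: "open U" and "p \<ge> 0" "q \<ge> 0"
  shows "val_integral (val_add (val_scale p (dirac \<mu>)) (val_scale q (dirac \<nu>))) (\<lambda>\<rho>. val \<rho> U)
    = ennreal p * val \<mu> U + ennreal q * val \<nu> U"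
proof -
  let ?i = "\<lambda>\<mu> r. indicator {r. ennreal r < val \<mu> U} r * indicator {0..} r :: ennreal"
  have "val_integral (val_add (val_scale p (dirac \<mu>)) (val_scale q (dirac \<nu>))) (\<lambda>\<rho>. val \<rho> U)
      = (\<integral>\<^sup>+ r. ennreal p * ?i \<mu> r + ennreal q * ?i \<nu> r \<partial>lborel)"
    unfolding val_integral_def
    by (intro nn_integral_cong)
      (simp add: val_val_add val_val_scale val_dirac_greater[OF U] indicator_def[of "{0..}"])
  also have "\<dots> = ennreal p * (\<integral>\<^sup>+ r. ?i \<mu> r \<partial>lborel) + ennreal q * (\<integral>\<^sup>+ r. ?i \<nu> r \<partial>lborel)"
    by (subst nn_integral_add) (auto simp: nn_integral_cmult)
  finally show ?thesis by (simp add: nn_integral_less_ennreal)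
qed

lemma val_mult_combination:
  assumes "p \<ge> 0" "q \<ge> 0"
  shows "val_mult (val_add (val_scale p (dirac \<mu>)) (val_scale q (dirac \<nu>))) =
    val_add (val_scale p \<mu>) (val_scale q \<nu>)" (is "val_mult ?\<Xi> = ?\<rho>")
proof -
  have "(\<lambda>U. if open U then val_integral ?\<Xi> (\<lambda>\<rho>. val \<rho> U) else 0) = val ?\<rho>"
    using assms val_not_open[of _ ?\<rho>]
    by (auto simp: fun_eq_iff val_integral_combination val_val_add val_val_scale)
  then show ?thesis by (simp add: val_mult_def val_inverse)
qed

lemma val_map_combination:
  assumes f: "continuous_on UNIV f"
  shows "val_map f (val_add (val_scale p \<mu>) (val_scale q \<nu>)) =
    val_add (val_scale p (val_map f \<mu>)) (val_scale q (val_map f \<nu>))"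
  by (rule valuation_eqI) (simp add: val_val_map[OF f] val_val_add val_val_scale)

lemma val_map_dirac:
  assumes f: "continuous_on UNIV f"
  shows "val_map f (dirac x) = dirac (f x)"
  by (rule valuation_eqI)
    (use f in \<open>auto simp: val_val_map[OF f] val_dirac continuous_on_open_vimage\<close>)

text \<open>The associativity law of the algebra at \<open>p\<close> times
  \<open>dirac \<mu>\<close> plus \<open>q\<close> times \<open>dirac \<nu>\<close>:
  \<open>val_mult\<close> removes the outer Dirac valuations, \<open>val_map \<alpha>\<close> moves
  \<open>\<alpha>\<close> inside them.\<close>

lemma Vw_algebra_combination:
  assumes \<alpha>: "Vw_algebra \<alpha>" and pq: "p \<ge> 0" "q \<ge> 0"
  shows "\<alpha> (val_add (val_scale p \<mu>) (val_scale q \<nu>)) =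
    \<alpha> (val_add (val_scale p (dirac (\<alpha> \<mu>))) (val_scale q (dirac (\<alpha> \<nu>))))"
proof -
  have cont: "continuous_on UNIV \<alpha>" and mult: "\<alpha> (val_mult \<Xi>) = \<alpha> (val_map \<alpha> \<Xi>)" for \<Xi>
    using \<alpha> by (auto simp: Vw_algebra_def dest: fun_cong)
  show ?thesis
    using mult[of "val_add (val_scale p (dirac \<mu>)) (val_scale q (dirac \<nu>))"]
    by (simp add: val_mult_combination[OF pq] val_map_combination[OF cont] val_map_dirac[OF cont])
qed

lemma Vw_algebra_dirac: "Vw_algebra \<alpha> \<Longrightarrow> \<alpha> (dirac x) = x"
  by (auto simp: Vw_algebra_def dest: fun_cong)

text \<open>\<open>\<alpha>\<close> is linear for the cone it induces.
  \<open>Vw_algebra_combination\<close> is applied twice: with coefficients \<open>1\<close> to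
  merge the two scaled points, then with \<open>p\<close> and \<open>q\<close>.\<close>

lemma cone_combination:
  assumes \<alpha>: "Vw_algebra \<alpha>" and pq: "p \<ge> 0" "q \<ge> 0"
  shows "cone_add \<alpha> (cone_scale \<alpha> p (\<alpha> \<mu>)) (cone_scale \<alpha> q (\<alpha> \<nu>)) =
    \<alpha> (val_add (val_scale p \<mu>) (val_scale q \<nu>))"
proof -
  have "cone_scale \<alpha> p x = \<alpha> (val_scale p (dirac x))" for p x by (simp add: cone_scale_def)
  then have "cone_add \<alpha> (cone_scale \<alpha> p (\<alpha> \<mu>)) (cone_scale \<alpha> q (\<alpha> \<nu>)) =
      \<alpha> (val_add (val_scale p (dirac (\<alpha> \<mu>))) (val_scale q (dirac (\<alpha> \<nu>))))"
    using Vw_algebra_combination[OF \<alpha>, of 1 1 "val_scale p (dirac (\<alpha> \<mu>))" "val_scale q (dirac (\<alpha> \<nu>))"]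
    by (simp add: cone_add_def val_scale_one)
  then show ?thesis by (simp add: Vw_algebra_combination[OF \<alpha> pq, of \<mu> \<nu>])
qed

lemma lsc_linear_algebra:
  assumes \<alpha>: "Vw_algebra \<alpha>" and lsc: "lsc \<Lambda>"
    and linear: "cone_linear (cone_add \<alpha>) (cone_scale \<alpha>) (+) (\<lambda>r t. ennreal r * t) \<Lambda>"
  shows "lsc_linear (\<lambda>\<mu>. \<Lambda> (\<alpha> \<mu>))"
proof
  show "lsc (\<lambda>\<mu>. \<Lambda> (\<alpha> \<mu>))"
    using lsc by (rule lsc_compose) (use \<alpha> in \<open>simp add: Vw_algebra_def\<close>)
  show "cone_linear val_add val_scale (+) (\<lambda>r t. ennreal r * t) (\<lambda>\<mu>. \<Lambda> (\<alpha> \<mu>))"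
    using linear by (simp add: cone_linear_def cone_combination[OF \<alpha>, symmetric])
qed

lemma lsc_linear_val_map:
  assumes "lsc_linear \<psi>" and f: "continuous_on UNIV f"
  shows "lsc_linear (\<lambda>\<mu>. \<psi> (val_map f \<mu>))"
proof
  show "lsc (\<lambda>\<mu>. \<psi> (val_map f \<mu>))"
    using lsc_linear.lsc[OF assms(1)] continuous_on_val_map[OF f] by (rule lsc_compose)
  show "cone_linear val_add val_scale (+) (\<lambda>r t. ennreal r * t) (\<lambda>\<mu>. \<psi> (val_map f \<mu>))"
    using lsc_linear.combination[OF assms(1)] by (simp add: cone_linear_def val_map_combination[OF f])
qed

section \<open>The two inclusions of the theorem\<close>

text \<open>A combination of two points is the image under the structure map of the same combination
  of their Dirac valuations, and \<open>val_map f\<close> carries such combinations over.\<close>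

lemma morphism_imp_linear:
  assumes \<alpha>: "Vw_algebra \<alpha>" and \<beta>: "Vw_algebra \<beta>" and f: "Vw_algebra_morphism \<alpha> \<beta> f"
  shows "cone_linear (cone_add \<alpha>) (cone_scale \<alpha>) (cone_add \<beta>) (cone_scale \<beta>) f"
  unfolding cone_linear_def
proof (intro allI impI)
  fix r s :: real and x y assume rs: "r \<ge> 0" "s \<ge> 0"
  have cont: "continuous_on UNIV f" and comm: "f (\<alpha> \<mu>) = \<beta> (val_map f \<mu>)" for \<mu>
    using f by (simp_all add: Vw_algebra_morphism_def fun_eq_iff)
  show "f (cone_add \<alpha> (cone_scale \<alpha> r x) (cone_scale \<alpha> s y)) =
      cone_add \<beta> (cone_scale \<beta> r (f x)) (cone_scale \<beta> s (f y))"
    using cone_combination[OF \<alpha> rs, of "dirac x" "dirac y"]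
      cone_combination[OF \<beta> rs, of "dirac (f x)" "dirac (f y)"]
    by (simp add: Vw_algebra_dirac[OF \<alpha>] Vw_algebra_dirac[OF \<beta>] comm
        val_map_combination[OF cont] val_map_dirac[OF cont])
qed

text \<open>A functional \<open>\<Lambda>\<close> that separated the two sides at
  \<open>\<mu>\<close> would give two functionals on valuations that both equal
  \<open>\<Lambda> (f x)\<close> at \<open>dirac x\<close> and yet differ at
  \<open>\<mu>\<close>.\<close>

lemma linear_imp_morphism:
  assumes \<alpha>: "Vw_algebra \<alpha>" and \<beta>: "Vw_algebra \<beta>"
    and T0: "convex_T0 (cone_add \<beta>) (cone_scale \<beta>)"
    and f: "continuous_on UNIV f"
    and linear: "cone_linear (cone_add \<alpha>) (cone_scale \<alpha>) (cone_add \<beta>) (cone_scale \<beta>) f"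
  shows "Vw_algebra_morphism \<alpha> \<beta> f"
proof -
  have "\<beta> (val_map f \<mu>) = f (\<alpha> \<mu>)" for \<mu>
  proof (rule ccontr)
    assume "\<beta> (val_map f \<mu>) \<noteq> f (\<alpha> \<mu>)"
    then obtain \<Lambda> :: "'b \<Rightarrow> ennreal" where \<Lambda>: "lsc \<Lambda>"
      "cone_linear (cone_add \<beta>) (cone_scale \<beta>) (+) (\<lambda>r t. ennreal r * t) \<Lambda>"
      and neq: "\<Lambda> (\<beta> (val_map f \<mu>)) \<noteq> \<Lambda> (f (\<alpha> \<mu>))"
      using T0 unfolding convex_T0_def by blast
    have "lsc_linear (\<lambda>\<mu>. \<Lambda> (\<beta> (val_map f \<mu>)))"
      using lsc_linear_algebra[OF \<beta> \<Lambda>] f by (rule lsc_linear_val_map)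
    moreover have "lsc_linear (\<lambda>\<mu>. \<Lambda> (f (\<alpha> \<mu>)))"
    proof (rule lsc_linear_algebra[OF \<alpha>])
      show "lsc (\<lambda>x. \<Lambda> (f x))" using \<Lambda>(1) f by (rule lsc_compose)
      show "cone_linear (cone_add \<alpha>) (cone_scale \<alpha>) (+) (\<lambda>r t. ennreal r * t) (\<lambda>x. \<Lambda> (f x))"
        using linear \<Lambda>(2) by (simp add: cone_linear_def)
    qed
    ultimately have "\<Lambda> (\<beta> (val_map f \<mu>)) = \<Lambda> (f (\<alpha> \<mu>))"
      by (rule lsc_linear_eqI)
        (simp add: val_map_dirac[OF f] Vw_algebra_dirac[OF \<alpha>] Vw_algebra_dirac[OF \<beta>])
    with neq show False ..
  qed
  then show ?thesis using f by (simp add: Vw_algebra_morphism_def fun_eq_iff)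
qed

theorem proposition4p16:
  fixes \<alpha> :: "'a::t0_space valuation \<Rightarrow> 'a"
    and \<beta> :: "'b::t0_space valuation \<Rightarrow> 'b"
  assumes "Vw_algebra \<alpha>"
    and "Vw_algebra \<beta>"
    and "convex_T0 (cone_add \<beta>) (cone_scale \<beta>)"
  shows "{f. Vw_algebra_morphism \<alpha> \<beta> f} =
    {f :: 'a \<Rightarrow> 'b. continuous_on UNIV f \<and>
       cone_linear (cone_add \<alpha>) (cone_scale \<alpha>) (cone_add \<beta>) (cone_scale \<beta>) f}"
proof (intro Collect_cong iffI conjI)
  fix f assume f: "Vw_algebra_morphism \<alpha> \<beta> f"
  then show "continuous_on UNIV f" by (simp add: Vw_algebra_morphism_def)
  show "cone_linear (cone_add \<alpha>) (cone_scale \<alpha>) (cone_add \<beta>) (cone_scale \<beta>) f"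
    using assms(1,2) f by (rule morphism_imp_linear)
next
  fix f :: "'a \<Rightarrow> 'b"
  assume "continuous_on UNIV f \<and>
    cone_linear (cone_add \<alpha>) (cone_scale \<alpha>) (cone_add \<beta>) (cone_scale \<beta>) f"
  then show "Vw_algebra_morphism \<alpha> \<beta> f" by (intro linear_imp_morphism[OF assms]) auto
qed

end
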